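(* Let $\mathscr{L}_S$ be the real affine variety of symmetrically mixed states of two qubits, with the action of $U_2$ by local unitary conjugation. Then the field $\mathbb{R}(\mathscr{L}_S)^{U_2}$ is purely transcendental over $\mathbb{R}$ of (transcendence) degree $6$.
   Context: Let $V_1=\mathbb{C}^2$ with the standard Hermitian inner product, $V=V_1\otimes V_1$, and let $U_2$ be the group of complex unitary $2\times2$ matrices. The Liouville space $\mathscr{L}$ is the real affine space of Hermitian operators $\rho$ on $V$ with $\operatorname{Tr}(\rho)=1$. Let $\tau:V\to V$ be the involution swapping the two tensor factors, and let $$\mathscr{L}_S=\{\rho\in\mathscr{L}:\tau\rho=\rho\tau\},$$ a real affine space of dimension $9$. The group $U_2$ acts on $\mathscr{L}_S$ by $U\cdot\rho=(U\otimes U)\,\rho\,(U\otimes U)^{*}$. $\mathbb{R}(\mathscr{L}_S)$ is the field of real-valued rational functions on $\mathscr{L}_S$ (the fraction field of the ring of real polynomial functions), and $\mathbb{R}(\mathscr{L}_S)^{U_2}$ is the subfield of rational functions $f$ with $f(gx)=f(x)$ for all $g\in U_2$. *)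

theory Defs
  imports
    "HOL-Analysis.Analysis"
    "HOL-Library.Poly_Mapping"
    "HOL-Computational_Algebra.Fraction_Field"
begin

section \<open>Purely transcendental subfields\<close>

text \<open>
  A base field is given by an embedding \<open>\<iota>\<close> into an ambient field.
  Polynomials in variables indexed by naturals are finitely supported maps from monomials
  (finitely supported exponent maps) to coefficients; \<open>poly_eval \<iota> t P\<close> is the value of
  \<open>P\<close> at the point \<open>t\<close>.
\<close>

definition poly_eval ::
    "('k::field \<Rightarrow> 'a::field) \<Rightarrow> (nat \<Rightarrow> 'a) \<Rightarrow> ((nat \<Rightarrow>\<^sub>0 nat) \<Rightarrow>\<^sub>0 'k) \<Rightarrow> 'a" where
  "poly_eval \<iota> t P =
    (\<Sum>m \<in> Poly_Mapping.keys P. \<iota> (Poly_Mapping.lookup P m) *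
      (\<Prod>i \<in> Poly_Mapping.keys m. t i ^ Poly_Mapping.lookup m i))"

definition alg_independent ::
    "('k::field \<Rightarrow> 'a::field) \<Rightarrow> nat \<Rightarrow> (nat \<Rightarrow> 'a) \<Rightarrow> bool" where
  "alg_independent \<iota> n t \<longleftrightarrow>
    (\<forall>P. (\<forall>m \<in> Poly_Mapping.keys P. Poly_Mapping.keys m \<subseteq> {..<n}) \<longrightarrow>
      poly_eval \<iota> t P = 0 \<longrightarrow> P = 0)"

inductive_set field_generated :: "'a::field set \<Rightarrow> 'a set" for S where
  one: "1 \<in> field_generated S"
| incl: "x \<in> S \<Longrightarrow> x \<in> field_generated S"
| diff: "x \<in> field_generated S \<Longrightarrow> y \<in> field_generated S \<Longrightarrow> x - y \<in> field_generated S"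
| mult: "x \<in> field_generated S \<Longrightarrow> y \<in> field_generated S \<Longrightarrow> x * y \<in> field_generated S"
| inverse: "x \<in> field_generated S \<Longrightarrow> inverse x \<in> field_generated S"

definition purely_transcendental ::
    "('k::field \<Rightarrow> 'a::field) \<Rightarrow> 'a set \<Rightarrow> nat \<Rightarrow> bool" where
  "purely_transcendental \<iota> K n \<longleftrightarrow>
    (\<exists>t. alg_independent \<iota> n t \<and> K = field_generated (range \<iota> \<union> t ` {..<n}))"


section \<open>Operators on two qubits\<close>

text \<open>
  \<open>V\<^sub>1 = \<complex>\<^sup>2\<close> is \<open>complex ^ 2\<close>, and \<open>V\<^sub>1 \<otimes> V\<^sub>1\<close> is \<open>complex ^ (2 \<times> 2)\<close>, where the
  coordinate \<open>(i, j)\<close> belongs to the basis vector \<open>e\<^sub>i \<otimes> e\<^sub>j\<close>. Operators are represented by their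
  matrices in these orthonormal bases.
\<close>

type_synonym qubit_op = "complex ^ 2 ^ 2"
type_synonym two_qubit_op = "complex ^ (2 \<times> 2) ^ (2 \<times> 2)"

definition tensor_vec :: "complex ^ 2 \<Rightarrow> complex ^ 2 \<Rightarrow> complex ^ (2 \<times> 2)" where
  "tensor_vec v w = (\<chi> i. v $ fst i * w $ snd i)"

definition adj :: "complex ^ 'n ^ 'n \<Rightarrow> complex ^ 'n ^ 'n" where
  "adj A = (\<chi> i j. cnj (A $ j $ i))"

definition hermitian :: "complex ^ 'n ^ 'n \<Rightarrow> bool" where
  "hermitian A \<longleftrightarrow> adj A = A"

definition unitary :: "complex ^ 'n ^ 'n \<Rightarrow> bool" where
  "unitary A \<longleftrightarrow> A ** adj A = mat 1 \<and> adj A ** A = mat 1"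

definition kron :: "qubit_op \<Rightarrow> qubit_op \<Rightarrow> two_qubit_op" where
  "kron A B = (\<chi> i j. A $ fst i $ fst j * B $ snd i $ snd j)"

definition swap_op :: two_qubit_op where
  "swap_op = (\<chi> i j. if i = prod.swap j then 1 else 0)"

lemma sum_UNIV_prod:
  "(\<Sum>k \<in> (UNIV :: ('a::finite \<times> 'b::finite) set). f k) = (\<Sum>i \<in> UNIV. \<Sum>j \<in> UNIV. f (i, j))"
  by (simp add: UNIV_Times_UNIV[symmetric] sum.cartesian_product' del: UNIV_Times_UNIV)

lemma kron_tensor_vec: "kron A B *v tensor_vec v w = tensor_vec (A *v v) (B *v w)"
  by (simp add: vec_eq_iff kron_def tensor_vec_def matrix_vector_mult_def sum_UNIV_prod
      sum_product algebra_simps)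

lemma swap_op_mult_left: "(swap_op ** A) $ i $ j = A $ prod.swap i $ j"
proof -
  have "(swap_op ** A) $ i $ j = (\<Sum>k\<in>UNIV. if k = prod.swap i then A $ k $ j else 0)"
    by (simp only: matrix_matrix_mult_def swap_op_def vec_lambda_beta) (rule sum.cong, auto)
  then show ?thesis by simp
qed

lemma swap_op_mult_right: "(A ** swap_op) $ i $ j = A $ i $ prod.swap j"
proof -
  have "(A ** swap_op) $ i $ j = (\<Sum>k\<in>UNIV. if k = prod.swap j then A $ i $ k else 0)"
    by (simp only: matrix_matrix_mult_def swap_op_def vec_lambda_beta) (rule sum.cong, auto)
  then show ?thesis by simp
qed

lemma swap_op_tensor_vec: "swap_op *v tensor_vec v w = tensor_vec w v"
proof -
  have "(swap_op *v x) $ i = x $ prod.swap i" for x i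
  proof -
    have "(swap_op *v x) $ i = (\<Sum>k\<in>UNIV. if k = prod.swap i then x $ k else 0)"
      by (simp only: matrix_vector_mult_def swap_op_def vec_lambda_beta) (rule sum.cong, auto)
    then show ?thesis by simp
  qed
  then show ?thesis
    by (simp add: vec_eq_iff tensor_vec_def)
qed

lemma kron_mult: "kron A B ** kron C D = kron (A ** C) (B ** D)"
  by (simp add: vec_eq_iff kron_def matrix_matrix_mult_def sum_UNIV_prod
      sum_product algebra_simps)

lemma kron_one: "kron (mat 1) (mat 1) = mat 1"
  by (auto simp: vec_eq_iff kron_def mat_def)

lemma adj_kron: "adj (kron A B) = kron (adj A) (adj B)"
  by (simp add: vec_eq_iff kron_def adj_def)

lemma adj_adj [simp]: "adj (adj A) = A"
  by (simp add: vec_eq_iff adj_def)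

lemma adj_mult: "adj (A ** B) = adj B ** adj A"
  by (simp add: vec_eq_iff adj_def matrix_matrix_mult_def mult.commute)

lemma adj_mat_1: "adj (mat 1) = mat 1"
  by (simp add: vec_eq_iff adj_def mat_def)

lemma unitary_adj: "unitary A \<Longrightarrow> unitary (adj A)"
  by (simp add: unitary_def)

lemma unitary_kron: "unitary A \<Longrightarrow> unitary B \<Longrightarrow> unitary (kron A B)"
  by (simp add: unitary_def adj_kron kron_mult kron_one)

lemma swap_op_kron: "swap_op ** kron A A = kron A A ** swap_op"
  by (simp add: vec_eq_iff swap_op_mult_left swap_op_mult_right)
    (simp add: kron_def mult.commute)


section \<open>Symmetrically mixed states and the action of the unitary group\<close>

definition liouville_space :: "two_qubit_op set" where
  "liouville_space = {\<rho>. hermitian \<rho> \<and> trace \<rho> = 1}"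

definition symmetric_liouville_space :: "two_qubit_op set" where
  "symmetric_liouville_space = {\<rho> \<in> liouville_space. swap_op ** \<rho> = \<rho> ** swap_op}"

lemma symmetric_liouville_space_affine:
  assumes "\<rho> \<in> symmetric_liouville_space" "\<sigma> \<in> symmetric_liouville_space"
  shows "(1 - t) *\<^sub>R \<rho> + t *\<^sub>R \<sigma> \<in> symmetric_liouville_space"
proof -
  have [simp]: "adj (a *\<^sub>R \<rho> + b *\<^sub>R \<sigma>) = a *\<^sub>R adj \<rho> + b *\<^sub>R adj \<sigma>" for a b
    by (simp add: vec_eq_iff adj_def)
  have [simp]: "trace (a *\<^sub>R \<rho> + b *\<^sub>R \<sigma>) = a *\<^sub>R trace \<rho> + b *\<^sub>R trace \<sigma>" for a b
    by (simp add: trace_def sum.distrib scaleR_sum_right)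
  have "\<rho> $ prod.swap i $ j = \<rho> $ i $ prod.swap j" "\<sigma> $ prod.swap i $ j = \<sigma> $ i $ prod.swap j" for i j
    using assms unfolding symmetric_liouville_space_def
    by (metis (mono_tags, lifting) mem_Collect_eq swap_op_mult_left swap_op_mult_right)+
  then have "swap_op ** (a *\<^sub>R \<rho> + b *\<^sub>R \<sigma>) = (a *\<^sub>R \<rho> + b *\<^sub>R \<sigma>) ** swap_op" for a b
    by (simp only: vec_eq_iff swap_op_mult_left swap_op_mult_right) simp
  moreover have "(1 - t) *\<^sub>R (1::complex) + t *\<^sub>R 1 = 1"
    by (simp add: scaleR_left_distrib[symmetric])
  ultimately show ?thesis
    using assms by (simp add: symmetric_liouville_space_def liouville_space_def hermitian_def)
qed

typedef sym_state = symmetric_liouville_space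
proof
  have "trace (mat (1/4) :: two_qubit_op) = 1"
    by (simp add: trace_def mat_def)
  then show "mat (1/4) \<in> symmetric_liouville_space"
    by (auto simp: symmetric_liouville_space_def liouville_space_def hermitian_def adj_def
        vec_eq_iff swap_op_mult_left swap_op_mult_right) (auto simp: mat_def)
qed

setup_lifting type_definition_sym_state

typedef unitary2 = "{U :: qubit_op. unitary U}"
  by (rule exI[of _ "mat 1"]) (simp add: unitary_def adj_mat_1)

setup_lifting type_definition_unitary2

lemma conj_in_symmetric_liouville_space:
  assumes "unitary U" and \<rho>: "\<rho> \<in> symmetric_liouville_space"
  shows "kron U U ** \<rho> ** adj (kron U U) \<in> symmetric_liouville_space"
proof -
  let ?W = "kron U U"
  have W: "adj ?W ** ?W = mat 1"
    using unitary_kron[OF assms(1) assms(1)] by (simp add: unitary_def)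
  have "trace (?W ** \<rho> ** adj ?W) = trace (adj ?W ** (?W ** \<rho>))"
    by (rule trace_mul_sym)
  also have "\<dots> = 1"
    using \<rho> W by (simp add: matrix_mul_assoc symmetric_liouville_space_def liouville_space_def)
  finally have "trace (?W ** \<rho> ** adj ?W) = 1" .
  moreover have "hermitian (?W ** \<rho> ** adj ?W)"
    using \<rho> by (simp add: hermitian_def adj_mult matrix_mul_assoc symmetric_liouville_space_def
        liouville_space_def)
  moreover have "swap_op ** (?W ** \<rho> ** adj ?W) = ?W ** \<rho> ** adj ?W ** swap_op"
  proof -
    have "swap_op ** (?W ** \<rho> ** adj ?W) = (swap_op ** ?W) ** \<rho> ** adj ?W"
      by (simp add: matrix_mul_assoc)
    also have "\<dots> = ?W ** (swap_op ** \<rho>) ** adj ?W"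
      by (simp add: swap_op_kron matrix_mul_assoc)
    also have "\<dots> = ?W ** \<rho> ** (swap_op ** adj ?W)"
      using \<rho> by (simp add: symmetric_liouville_space_def matrix_mul_assoc)
    also have "\<dots> = ?W ** \<rho> ** adj ?W ** swap_op"
      by (simp add: adj_kron swap_op_kron matrix_mul_assoc)
    finally show ?thesis .
  qed
  ultimately show ?thesis
    by (simp add: symmetric_liouville_space_def liouville_space_def)
qed

lift_definition act :: "unitary2 \<Rightarrow> sym_state \<Rightarrow> sym_state" is
  "\<lambda>U \<rho>. kron U U ** \<rho> ** adj (kron U U)"
  by (rule conj_in_symmetric_liouville_space)

lift_definition unitary2_inv :: "unitary2 \<Rightarrow> unitary2" is adj
  by (rule unitary_adj)

lemma act_inv: "act g (act (unitary2_inv g) x) = x"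
proof transfer
  fix U :: qubit_op and \<rho>
  assume "unitary U"
  then have W: "kron U U ** adj (kron U U) = mat 1"
    using unitary_kron[of U U] by (simp add: unitary_def)
  have "kron U U ** (adj (kron U U) ** \<rho> ** kron U U) ** adj (kron U U)
      = (kron U U ** adj (kron U U)) ** \<rho> ** (kron U U ** adj (kron U U))"
    by (simp only: matrix_mul_assoc)
  then show "kron U U ** (kron (adj U) (adj U) ** \<rho> ** adj (kron (adj U) (adj U))) **
      adj (kron U U) = \<rho>"
    by (simp add: W adj_kron[symmetric])
qed


section \<open>Polynomial and rational functions on the space of symmetric states\<close>

text \<open>
  Polynomial functions on the affine subspace are the restrictions of real polynomial functions
  on the ambient real vector space of matrices.
\<close>

typedef state_poly =
  "{f :: sym_state \<Rightarrow> real. \<exists>p. real_polynomial_function p \<and> (\<forall>x. f x = p (Rep_sym_state x))}"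
  morphisms poly_fun Abs_state_poly
  by (rule exI[of _ "\<lambda>_. 0"]) auto

setup_lifting type_definition_state_poly

lemma state_poly_eq_iff: "f = g \<longleftrightarrow> (\<forall>x. poly_fun f x = poly_fun g x)"
  by (simp add: poly_fun_inject[symmetric] fun_eq_iff)

lemma state_poly_along_line:
  "\<exists>q. real_polynomial_function q \<and>
    (\<forall>t. poly_fun f (Abs_sym_state ((1 - t) *\<^sub>R Rep_sym_state x + t *\<^sub>R Rep_sym_state y)) = q t)"
proof -
  obtain p where p: "real_polynomial_function p" "\<And>x. poly_fun f x = p (Rep_sym_state x)"
    using poly_fun[of f] by auto
  have "polynomial_function (\<lambda>t. (1 - t) *\<^sub>R Rep_sym_state x + t *\<^sub>R Rep_sym_state y)"
    by (intro polynomial_function_add polynomial_function_mult polynomial_function_diff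
        polynomial_function_const polynomial_function_id)
  from real_polynomial_function_compose[OF this p(1)]
  have "real_polynomial_function
      (\<lambda>t. p ((1 - t) *\<^sub>R Rep_sym_state x + t *\<^sub>R Rep_sym_state y))"
    by (simp add: o_def)
  then show ?thesis
    using p(2) Abs_sym_state_inverse[OF symmetric_liouville_space_affine[OF Rep_sym_state Rep_sym_state]]
    by auto
qed

instantiation state_poly :: idom
begin

lift_definition zero_state_poly :: state_poly is "\<lambda>_. 0"
  by (rule exI[of _ "\<lambda>_. 0"]) auto
lift_definition one_state_poly :: state_poly is "\<lambda>_. 1"
  by (rule exI[of _ "\<lambda>_. 1"]) auto
lift_definition plus_state_poly :: "state_poly \<Rightarrow> state_poly \<Rightarrow> state_poly" is
  "\<lambda>f g x. f x + g x"
  by (elim exE conjE) (rule exI, rule conjI, erule (1) real_polynomial_function.intros(3), simp)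
lift_definition minus_state_poly :: "state_poly \<Rightarrow> state_poly \<Rightarrow> state_poly" is
  "\<lambda>f g x. f x - g x"
  by (elim exE conjE) (rule exI, rule conjI, erule (1) real_polynomial_function_diff, simp)
lift_definition uminus_state_poly :: "state_poly \<Rightarrow> state_poly" is
  "\<lambda>f x. - f x"
  by (elim exE conjE) (rule exI, rule conjI, erule real_polynomial_function_minus, simp)
lift_definition times_state_poly :: "state_poly \<Rightarrow> state_poly \<Rightarrow> state_poly" is
  "\<lambda>f g x. f x * g x"
  by (elim exE conjE) (rule exI, rule conjI, erule (1) real_polynomial_function.intros(4), simp)

instance
proof
  fix f g :: state_poly
  assume "f \<noteq> 0" "g \<noteq> 0"
  then obtain x y where x: "poly_fun f x \<noteq> 0" and y: "poly_fun g y \<noteq> 0"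
    by (auto simp: state_poly_eq_iff zero_state_poly.rep_eq)
  define l where "l t = Abs_sym_state ((1 - t) *\<^sub>R Rep_sym_state x + t *\<^sub>R Rep_sym_state y)" for t
  have l: "l 0 = x" "l 1 = y"
    by (simp_all add: l_def Rep_sym_state_inverse)
  obtain p where p: "real_polynomial_function p" "\<And>t. poly_fun f (l t) = p t"
    using state_poly_along_line[of f x y] unfolding l_def by blast
  obtain q where q: "real_polynomial_function q" "\<And>t. poly_fun g (l t) = q t"
    using state_poly_along_line[of g x y] unfolding l_def by blast
  obtain a n where a: "p = (\<lambda>t. \<Sum>i\<le>n. a i * t ^ i)"
    using p(1) unfolding real_polynomial_function_iff_sum by (elim exE)
  obtain b m where b: "q = (\<lambda>t. \<Sum>i\<le>m. b i * t ^ i)"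
    using q(1) unfolding real_polynomial_function_iff_sum by (elim exE)
  define P Q where "P = (\<Sum>i\<le>n. monom (a i) i)" and "Q = (\<Sum>i\<le>m. monom (b i) i)"
  have PQ: "poly P t = p t" "poly Q t = q t" for t
    by (simp_all add: P_def Q_def a b poly_sum poly_monom)
  have "P \<noteq> 0" "Q \<noteq> 0"
  proof -
    have "poly P 0 \<noteq> 0" "poly Q 1 \<noteq> 0"
      using x y by (simp_all add: PQ p(2)[symmetric] q(2)[symmetric] l)
    then show "P \<noteq> 0" "Q \<noteq> 0" by auto
  qed
  then have "P * Q \<noteq> 0" by simp
  then obtain t where "poly (P * Q) t \<noteq> 0"
    using poly_all_0_iff_0 by blast
  then have "poly_fun (f * g) (l t) \<noteq> 0"
    using p(2) q(2) PQ by (simp add: times_state_poly.rep_eq)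
  then show "f * g \<noteq> 0"
    by (auto simp: zero_state_poly.rep_eq)
next
  show "(0::state_poly) \<noteq> 1"
    by (simp add: state_poly_eq_iff zero_state_poly.rep_eq one_state_poly.rep_eq)
qed (simp_all add: state_poly_eq_iff zero_state_poly.rep_eq one_state_poly.rep_eq
    plus_state_poly.rep_eq minus_state_poly.rep_eq uminus_state_poly.rep_eq
    times_state_poly.rep_eq algebra_simps)

end

lift_definition const_poly :: "real \<Rightarrow> state_poly" is "\<lambda>c _. c"
  by (rule exI[of _ "\<lambda>_. c" for c]) auto

type_synonym state_rat = "state_poly fract"

definition const_rat :: "real \<Rightarrow> state_rat" where
  "const_rat c = Fract (const_poly c) 1"

lift_definition pull_poly :: "unitary2 \<Rightarrow> state_poly \<Rightarrow> state_poly" is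
  "\<lambda>g f x. f (act g x)"
proof -
  fix g and f :: "sym_state \<Rightarrow> real"
  assume "\<exists>p. real_polynomial_function p \<and> (\<forall>x. f x = p (Rep_sym_state x))"
  then obtain p where p: "real_polynomial_function p" "\<And>x. f x = p (Rep_sym_state x)"
    by auto
  define W where "W = kron (Rep_unitary2 g) (Rep_unitary2 g)"
  have "linear (\<lambda>\<rho> :: two_qubit_op. W ** \<rho> ** adj W)"
  proof (rule linearI)
    fix r and \<rho> :: two_qubit_op
    show "W ** (r *\<^sub>R \<rho>) ** adj W = r *\<^sub>R (W ** \<rho> ** adj W)"
      by (simp add: vec_eq_iff matrix_matrix_mult_def scaleR_sum_right[symmetric])
  qed (simp add: matrix_matrix_mult_def vec_eq_iff sum.distrib distrib_left distrib_right)
  then have "polynomial_function (\<lambda>\<rho> :: two_qubit_op. W ** \<rho> ** adj W)"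
    by (simp add: linear_conv_bounded_linear polynomial_function_bounded_linear)
  from real_polynomial_function_compose[OF this p(1)]
  show "\<exists>q. real_polynomial_function q \<and> (\<forall>x. f (act g x) = q (Rep_sym_state x))"
    by (auto simp: p(2) act.rep_eq W_def o_def)
qed

lemma pull_poly_mult: "pull_poly g (p * q) = pull_poly g p * pull_poly g q"
  by (simp add: state_poly_eq_iff times_state_poly.rep_eq pull_poly.rep_eq)

lemma pull_poly_eq_0: "pull_poly g p = 0 \<longleftrightarrow> p = 0"
proof
  assume *: "pull_poly g p = 0"
  have "poly_fun p x = 0" for x
    using arg_cong[OF *, of "\<lambda>f. poly_fun f (act (unitary2_inv g) x)"]
    by (simp add: pull_poly.rep_eq zero_state_poly.rep_eq act_inv)
  then show "p = 0"
    by (simp add: state_poly_eq_iff zero_state_poly.rep_eq)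
qed (simp add: state_poly_eq_iff zero_state_poly.rep_eq pull_poly.rep_eq)

text \<open>
  \<open>pull_rat g f\<close> is the rational function \<open>x \<mapsto> f (g x)\<close>.
\<close>

lift_definition pull_rat :: "unitary2 \<Rightarrow> state_rat \<Rightarrow> state_rat" is
  "\<lambda>g (p, q). (pull_poly g p, pull_poly g q)"
  by (auto simp: pull_poly_eq_0 pull_poly_mult[symmetric])

lemma pull_rat_Fract: "q \<noteq> 0 \<Longrightarrow> pull_rat g (Fract p q) = Fract (pull_poly g p) (pull_poly g q)"
  by (simp add: Fract_def pull_rat.abs_eq pull_poly_eq_0)

definition invariant_rats :: "state_rat set" where
  "invariant_rats = {f. \<forall>g. pull_rat g f = f}"

end

theory Submission
  imports Defs
begin

text \<open>
  In Bloch coordinates a symmetric state is a pair of a vector \<open>v\<close> in \<open>\<real>\<^sup>3\<close> and a symmetric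
  \<open>3 \<times> 3\<close> matrix \<open>S\<close>, on which \<open>U\<^sub>2\<close> acts by simultaneous rotation. Generators of the invariant
  field are \<open>v \<bullet> S\<^sup>k v\<close> for \<open>k \<le> 3\<close>, \<open>d = det (v, S v, S\<^sup>2 v)\<close> and \<open>tr S\<close>. A generic pair
  can be rotated so that \<open>v = (s, 0, 0)\<close> and \<open>S\<close> is tridiagonal with diagonal \<open>a1, a2, a3\<close> and
  off-diagonal \<open>b1, b2\<close>; then \<open>s\<^sup>2\<close>, \<open>b1\<^sup>2\<close>, \<open>a1\<close>, \<open>a2\<close>, \<open>a3\<close> and \<open>b2 / s\<close> are rational in the
  generators. Here \<open>d = s\<^sup>3 b1\<^sup>2 b2\<close> replaces \<open>b2\<^sup>2\<close>, which is what makes the field rational.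
  A polynomial restricted to this slice has the form \<open>h0 + b1 h1 + s h2 + s b1 h3\<close> with
  \<open>hi\<close> rational in the generators. For an invariant fraction \<open>p / q\<close>, comparing the four
  equivalent sign choices of \<open>(s, b1)\<close> shows \<open>p / q = hi / ki\<close> for some component \<open>ki \<noteq> 0\<close> of \<open>q\<close>.
  The generators are independent because their joint image contains a box.
\<close>

section \<open>Invariants of symmetric states\<close>

text \<open>This is the trace over the second factor of \<open>\<rho> ** kron (mat 1) A\<close>. Up
  to a scalar matrix, the weight \<open>mat 1\<close> extracts the Bloch vector v and a Pauli weight
  with vector w yields S w.\<close>

definition partial_trace :: "two_qubit_op \<Rightarrow> qubit_op \<Rightarrow> qubit_op" where
  "partial_trace \<rho> A = (\<chi> i k. \<Sum>j\<in>UNIV. \<Sum>l\<in>UNIV. \<rho> $ (i, j) $ (k, l) * A $ l $ j)"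

text \<open>For a Pauli weight with vector w the scalar part removed here is the inner product of v
  and w.\<close>

definition traceless_ptrace :: "two_qubit_op \<Rightarrow> qubit_op \<Rightarrow> qubit_op" where
  "traceless_ptrace \<rho> A = partial_trace \<rho> A - mat (trace (partial_trace \<rho> A) / 2)"

primrec krylov :: "two_qubit_op \<Rightarrow> nat \<Rightarrow> qubit_op" where
  "krylov \<rho> 0 = traceless_ptrace \<rho> (mat 1)"
| "krylov \<rho> (Suc k) = traceless_ptrace \<rho> (krylov \<rho> k)"

text \<open>
  In Bloch coordinates \<open>(v, S)\<close>, \<open>krylov \<rho> k\<close> is the traceless Hermitian matrix of the vector
  \<open>S\<^sup>k v\<close>, so the invariants below are \<open>v \<bullet> v\<close>, \<open>v \<bullet> S v\<close>, \<open>v \<bullet> S\<^sup>2 v\<close>, \<open>v \<bullet> S\<^sup>3 v\<close>,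
  \<open>det (v, S v, S\<^sup>2 v)\<close> and \<open>tr S\<close>.
\<close>

definition inv_fun :: "nat \<Rightarrow> two_qubit_op \<Rightarrow> real" where
  "inv_fun i \<rho> =
    (if i = 0 then Re (trace (krylov \<rho> 0 ** krylov \<rho> 0)) / 2
     else if i = 1 then Re (trace (krylov \<rho> 0 ** krylov \<rho> 1)) / 2
     else if i = 2 then Re (trace (krylov \<rho> 1 ** krylov \<rho> 1)) / 2
     else if i = 3 then Re (trace (krylov \<rho> 1 ** krylov \<rho> 2)) / 2
     else if i = 4 then Im (trace (krylov \<rho> 0 ** krylov \<rho> 1 ** krylov \<rho> 2)) / 2
     else Re (trace (\<rho> ** swap_op)) - 1 / 2)"

text \<open>This adjunction characterises the partial trace, so equivariance can be proved without
  computing entries.\<close>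

lemma trace_partial_trace: "trace (B ** partial_trace \<rho> A) = trace (\<rho> ** kron B A)"
proof -
  have "trace (B ** partial_trace \<rho> A) =
      (\<Sum>k\<in>UNIV. \<Sum>i\<in>UNIV. \<Sum>j\<in>UNIV. \<Sum>l\<in>UNIV. \<rho> $ (i, j) $ (k, l) * (B $ k $ i * A $ l $ j))"
    by (simp add: trace_def matrix_matrix_mult_def partial_trace_def sum_distrib_left mult_ac)
  also have "\<dots> = (\<Sum>i\<in>UNIV. \<Sum>k\<in>UNIV. \<Sum>j\<in>UNIV. \<Sum>l\<in>UNIV. \<rho> $ (i, j) $ (k, l) * (B $ k $ i * A $ l $ j))"
    by (rule sum.swap)
  also have "\<dots> = (\<Sum>i\<in>UNIV. \<Sum>j\<in>UNIV. \<Sum>k\<in>UNIV. \<Sum>l\<in>UNIV. \<rho> $ (i, j) $ (k, l) * (B $ k $ i * A $ l $ j))"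
    by (intro sum.cong refl sum.swap)
  also have "\<dots> = trace (\<rho> ** kron B A)"
    by (simp add: trace_def matrix_matrix_mult_def kron_def sum_UNIV_prod)
  finally show ?thesis .
qed

text \<open>The trace pairing is nondegenerate: testing against matrix units reads off the
  entries.\<close>

lemma trace_mult_eqD:
  fixes X Y :: "'a::comm_ring_1 ^ 'n ^ 'n"
  assumes "\<And>B. trace (B ** X) = trace (B ** Y)"
  shows "X = Y"
proof -
  have "trace ((\<chi> a b. if a = j \<and> b = i then 1 else 0) ** Z) = Z $ i $ j"
    for Z :: "'a ^ 'n ^ 'n" and i j
  proof -
    have "trace ((\<chi> a b. if a = j \<and> b = i then 1 else 0) ** Z) =
        (\<Sum>a\<in>UNIV. \<Sum>b\<in>UNIV. if a = j then (if b = i then Z $ b $ a else 0) else 0)"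
      unfolding trace_def matrix_matrix_mult_def by (auto intro!: sum.cong)
    also have "\<dots> = (\<Sum>a\<in>UNIV. if a = j then Z $ i $ a else 0)"
      by (intro sum.cong refl) simp
    finally show ?thesis by simp
  qed
  then have "X $ i $ j = Y $ i $ j" for i j
    using assms[of "\<chi> a b. if a = j \<and> b = i then 1 else 0"] by simp
  then show ?thesis by (simp add: vec_eq_iff)
qed

lemma unitary_conj_cancel:
  assumes "unitary U"
  shows "(U ** A ** adj U) ** (U ** B ** adj U) = U ** (A ** B) ** adj U"
proof -
  have "(U ** A ** adj U) ** (U ** B ** adj U) = U ** A ** (adj U ** U) ** B ** adj U"
    by (simp add: matrix_mul_assoc)
  also have "adj U ** U = mat 1"
    using assms by (simp add: unitary_def)
  finally show ?thesis by (simp add: matrix_mul_assoc)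
qed

lemma trace_unitary_conj:
  fixes U :: "complex ^ 'n ^ 'n"
  assumes "unitary U"
  shows "trace (U ** A ** adj U) = trace A"
  using assms trace_mul_sym[of "U ** A" "adj U"] by (simp add: unitary_def matrix_mul_assoc)

text \<open>Both sides are paired with an arbitrary \<open>B\<close>. Cyclicity of the trace moves
  the conjugation from \<open>\<rho>\<close> to \<open>kron B A\<close>, where it acts on each
  factor.\<close>

lemma partial_trace_conj:
  assumes "unitary U"
  shows "partial_trace (kron U U ** \<rho> ** adj (kron U U)) (U ** A ** adj U)
    = U ** partial_trace \<rho> A ** adj U"
proof (rule trace_mult_eqD)
  fix B
  let ?W = "kron U U"
  have U: "adj U ** U = mat 1"
    using assms by (simp add: unitary_def)
  have "adj ?W ** kron B (U ** A ** adj U) ** ?W = kron (adj U ** B ** U) A"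
  proof -
    have "adj U ** (U ** A ** adj U) ** U = (adj U ** U) ** A ** (adj U ** U)"
      by (simp only: matrix_mul_assoc)
    then show ?thesis by (simp add: adj_kron kron_mult U)
  qed
  moreover have "trace (B ** partial_trace (?W ** \<rho> ** adj ?W) (U ** A ** adj U)) =
      trace (\<rho> ** (adj ?W ** kron B (U ** A ** adj U) ** ?W))"
    using trace_mul_sym[of ?W "\<rho> ** adj ?W ** kron B (U ** A ** adj U)"]
    by (simp add: trace_partial_trace matrix_mul_assoc)
  ultimately have "trace (B ** partial_trace (?W ** \<rho> ** adj ?W) (U ** A ** adj U)) =
      trace (adj U ** B ** U ** partial_trace \<rho> A)"
    by (simp add: trace_partial_trace)
  also have "\<dots> = trace (B ** (U ** partial_trace \<rho> A ** adj U))"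
    using trace_mul_sym[of "adj U" "B ** U ** partial_trace \<rho> A"] by (simp add: matrix_mul_assoc)
  finally show "trace (B ** partial_trace (?W ** \<rho> ** adj ?W) (U ** A ** adj U)) =
      trace (B ** (U ** partial_trace \<rho> A ** adj U))" .
qed

lemma unitary_conj_mat:
  fixes U :: "complex ^ 'n ^ 'n"
  assumes "unitary U"
  shows "U ** mat c ** adj U = mat c"
proof -
  have "U ** mat c = mat c ** U"
    by (simp add: vec_eq_iff matrix_matrix_mult_def mat_def if_distrib if_distribR cong: if_cong)
  then show ?thesis
    using assms by (simp add: unitary_def flip: matrix_mul_assoc)
qed

lemma traceless_ptrace_conj:
  assumes "unitary U"
  shows "traceless_ptrace (kron U U ** \<rho> ** adj (kron U U)) (U ** A ** adj U)
    = U ** traceless_ptrace \<rho> A ** adj U"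
proof -
  have "U ** (X - mat c) ** adj U = U ** X ** adj U - U ** mat c ** adj U" for X c
    by (simp add: vec_eq_iff matrix_matrix_mult_def algebra_simps sum_subtractf)
  then show ?thesis
    by (simp add: traceless_ptrace_def partial_trace_conj assms trace_unitary_conj unitary_conj_mat)
qed

lemma krylov_conj:
  assumes "unitary U"
  shows "krylov (kron U U ** \<rho> ** adj (kron U U)) k = U ** krylov \<rho> k ** adj U"
proof (induction k)
  case 0
  then show ?case
    using traceless_ptrace_conj[OF assms, of \<rho> "mat 1"] unitary_conj_mat[OF assms, of 1] by simp
next
  case (Suc k)
  then show ?case by (simp add: traceless_ptrace_conj assms)
qed

text \<open>The first five are traces of words in matrices that are all conjugated by
  \<open>U\<close>; for the last one, \<open>swap_op\<close> commutes with
  \<open>kron U U\<close>.\<close>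

lemma inv_fun_conj:
  assumes "unitary U"
  shows "inv_fun i (kron U U ** \<rho> ** adj (kron U U)) = inv_fun i \<rho>"
proof -
  let ?W = "kron U U"
  have "?W ** \<rho> ** adj ?W ** swap_op = ?W ** (\<rho> ** swap_op) ** adj ?W"
    by (simp add: adj_kron swap_op_kron flip: matrix_mul_assoc)
  then have "trace (?W ** \<rho> ** adj ?W ** swap_op) = trace (\<rho> ** swap_op)"
    by (simp add: trace_unitary_conj unitary_kron assms)
  then show ?thesis
    by (simp add: inv_fun_def krylov_conj unitary_conj_cancel trace_unitary_conj assms
        del: krylov.simps)
qed

section \<open>Polynomiality of the invariants\<close>

text \<open>Matrix entries are complex while polynomial functions are real. Carrying both parts
  gives a class closed under ring operations, hence under matrix products and traces.\<close>

definition complex_poly :: "('a::real_normed_vector \<Rightarrow> complex) \<Rightarrow> bool" where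
  "complex_poly f \<longleftrightarrow>
    real_polynomial_function (\<lambda>x. Re (f x)) \<and> real_polynomial_function (\<lambda>x. Im (f x))"

lemma complex_poly_const: "complex_poly (\<lambda>_. c)"
  by (simp add: complex_poly_def real_polynomial_function.intros)

lemma complex_poly_add: "complex_poly f \<Longrightarrow> complex_poly g \<Longrightarrow> complex_poly (\<lambda>x. f x + g x)"
  by (simp add: complex_poly_def real_polynomial_function.intros)

lemma complex_poly_diff: "complex_poly f \<Longrightarrow> complex_poly g \<Longrightarrow> complex_poly (\<lambda>x. f x - g x)"
  by (simp add: complex_poly_def real_polynomial_function_diff)

lemma complex_poly_mult: "complex_poly f \<Longrightarrow> complex_poly g \<Longrightarrow> complex_poly (\<lambda>x. f x * g x)"
  by (simp add: complex_poly_def real_polynomial_function.intros real_polynomial_function_diff)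

lemma complex_poly_sum: "(\<And>i. i \<in> I \<Longrightarrow> complex_poly (f i)) \<Longrightarrow> complex_poly (\<lambda>x. \<Sum>i\<in>I. f i x)"
  by (induction I rule: infinite_finite_induct) (simp_all add: complex_poly_const complex_poly_add)

lemma complex_poly_entry: "complex_poly (\<lambda>\<rho> :: complex ^ 'm::finite ^ 'n::finite. \<rho> $ i $ j)"
proof -
  have "bounded_linear (\<lambda>\<rho> :: complex ^ 'm ^ 'n. \<rho> $ i $ j)"
    by (intro bounded_linear_compose[OF bounded_linear_vec_nth] bounded_linear_vec_nth)
  then show ?thesis
    by (simp add: complex_poly_def real_polynomial_function.intros(1)
        bounded_linear_compose[OF bounded_linear_Re] bounded_linear_compose[OF bounded_linear_Im])
qed

lemma complex_poly_traceless_ptrace: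
  assumes "\<And>i j. complex_poly (\<lambda>\<rho>. F \<rho> $ i $ j)"
  shows "complex_poly (\<lambda>\<rho>. traceless_ptrace \<rho> (F \<rho>) $ i $ j)"
proof -
  have P: "complex_poly (\<lambda>\<rho>. partial_trace \<rho> (F \<rho>) $ i $ j)" for i j
    unfolding partial_trace_def vec_lambda_beta
    by (intro complex_poly_sum complex_poly_mult complex_poly_entry assms)
  then have "complex_poly (\<lambda>\<rho>. (1 / 2) * trace (partial_trace \<rho> (F \<rho>)))"
    unfolding trace_def by (intro complex_poly_mult complex_poly_const complex_poly_sum)
  then show ?thesis
    unfolding traceless_ptrace_def vector_minus_component
    by (intro complex_poly_diff P) (cases "i = j"; simp add: mat_def complex_poly_const)
qed

lemma complex_poly_krylov: "complex_poly (\<lambda>\<rho>. krylov \<rho> k $ i $ j)"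
  by (induction k arbitrary: i j)
    (simp_all add: complex_poly_traceless_ptrace complex_poly_const)

lemma complex_poly_matrix_mult:
  assumes "\<And>i j. complex_poly (\<lambda>\<rho>. F \<rho> $ i $ j)" "\<And>i j. complex_poly (\<lambda>\<rho>. G \<rho> $ i $ j)"
  shows "complex_poly (\<lambda>\<rho>. (F \<rho> ** G \<rho>) $ i $ j)"
  unfolding matrix_matrix_mult_def vec_lambda_beta
  by (intro complex_poly_sum complex_poly_mult assms)

lemma complex_poly_trace:
  assumes "\<And>i j. complex_poly (\<lambda>\<rho>. F \<rho> $ i $ j)"
  shows "complex_poly (\<lambda>\<rho>. trace (F \<rho>))"
  unfolding trace_def by (intro complex_poly_sum assms)

lemma real_polynomial_inv_fun: "real_polynomial_function (inv_fun i)"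
proof -
  have half: "real_polynomial_function (\<lambda>x. f x / 2)"
    if "real_polynomial_function f" for f :: "two_qubit_op \<Rightarrow> real"
    using real_polynomial_function.intros(4)[OF that real_polynomial_function.intros(2), of "1/2"]
    by simp
  have kk: "complex_poly (\<lambda>\<rho>. trace (krylov \<rho> j ** krylov \<rho> k))"
    "complex_poly (\<lambda>\<rho>. trace (krylov \<rho> j ** krylov \<rho> k ** krylov \<rho> l))"
    "complex_poly (\<lambda>\<rho>. trace (\<rho> ** swap_op))" for j k l
    by (intro complex_poly_trace complex_poly_matrix_mult complex_poly_krylov complex_poly_entry
        complex_poly_const)+
  have "real_polynomial_function (\<lambda>\<rho>. Re (trace (krylov \<rho> j ** krylov \<rho> k)) / 2)"
    "real_polynomial_function (\<lambda>\<rho>. Im (trace (krylov \<rho> j ** krylov \<rho> k ** krylov \<rho> l)) / 2)"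
    "real_polynomial_function (\<lambda>\<rho>. Re (trace (\<rho> ** swap_op)) - 1 / 2)" for j k l
    using kk[unfolded complex_poly_def]
    by (auto intro!: half real_polynomial_function_diff real_polynomial_function.intros(2)
        simp del: krylov.simps)
  then show ?thesis
    unfolding inv_fun_def[abs_def]
    by (cases "i < 5") (auto simp: eval_nat_numeral less_Suc_eq simp del: krylov.simps)
qed

section \<open>Tridiagonal normal form\<close>

definition pauli :: "real \<Rightarrow> real \<Rightarrow> real \<Rightarrow> qubit_op" where
  "pauli x y z = vector [vector [of_real z, Complex x (- y)], vector [Complex x y, - of_real z]]"

abbreviation "pauli_x \<equiv> pauli 1 0 0"
abbreviation "pauli_y \<equiv> pauli 0 1 0"
abbreviation "pauli_z \<equiv> pauli 0 0 1"

text \<open>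
  In the axis order \<open>z, x, y\<close> the vector is \<open>(s, 0, 0)\<close> and the symmetric matrix is tridiagonal
  with diagonal \<open>a1, a2, a3\<close> and off-diagonal \<open>b1, b2\<close>.
\<close>

definition slice_op :: "real \<Rightarrow> real \<Rightarrow> real \<Rightarrow> real \<Rightarrow> real \<Rightarrow> real \<Rightarrow> two_qubit_op" where
  "slice_op s a1 b1 a2 b2 a3 = mat (1 / 4)
    + s *\<^sub>R ((1 / 2) *\<^sub>R (kron pauli_z (mat 1) + kron (mat 1) pauli_z))
    + a1 *\<^sub>R ((1 / 2) *\<^sub>R kron pauli_z pauli_z)
    + b1 *\<^sub>R ((1 / 2) *\<^sub>R (kron pauli_z pauli_x + kron pauli_x pauli_z))
    + a2 *\<^sub>R ((1 / 2) *\<^sub>R kron pauli_x pauli_x)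
    + b2 *\<^sub>R ((1 / 2) *\<^sub>R (kron pauli_x pauli_y + kron pauli_y pauli_x))
    + a3 *\<^sub>R ((1 / 2) *\<^sub>R kron pauli_y pauli_y)"

lemma pauli_nth [simp]:
  "pauli x y z $ 1 $ 1 = of_real z" "pauli x y z $ 1 $ 2 = Complex x (- y)"
  "pauli x y z $ 2 $ 1 = Complex x y" "pauli x y z $ 2 $ 2 = - of_real z"
  by (simp_all add: pauli_def)

lemma two_qubit_op_eq_iff:
  "\<rho> = \<sigma> \<longleftrightarrow> (\<forall>i j k l. (\<rho> :: two_qubit_op) $ (i, j) $ (k, l) = \<sigma> $ (i, j) $ (k, l))"
  by (simp add: vec_eq_iff)

lemma slice_op_nth:
  "slice_op s a1 b1 a2 b2 a3 $ (1, 1) $ (1, 1) = of_real (1 / 4 + s + a1 / 2)"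
  "slice_op s a1 b1 a2 b2 a3 $ (1, 1) $ (1, 2) = of_real (b1 / 2)"
  "slice_op s a1 b1 a2 b2 a3 $ (1, 1) $ (2, 1) = of_real (b1 / 2)"
  "slice_op s a1 b1 a2 b2 a3 $ (1, 1) $ (2, 2) = Complex ((a2 - a3) / 2) (- b2)"
  "slice_op s a1 b1 a2 b2 a3 $ (1, 2) $ (1, 1) = of_real (b1 / 2)"
  "slice_op s a1 b1 a2 b2 a3 $ (1, 2) $ (1, 2) = of_real (1 / 4 - a1 / 2)"
  "slice_op s a1 b1 a2 b2 a3 $ (1, 2) $ (2, 1) = of_real ((a2 + a3) / 2)"
  "slice_op s a1 b1 a2 b2 a3 $ (1, 2) $ (2, 2) = of_real (- b1 / 2)"
  "slice_op s a1 b1 a2 b2 a3 $ (2, 1) $ (1, 1) = of_real (b1 / 2)"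
  "slice_op s a1 b1 a2 b2 a3 $ (2, 1) $ (1, 2) = of_real ((a2 + a3) / 2)"
  "slice_op s a1 b1 a2 b2 a3 $ (2, 1) $ (2, 1) = of_real (1 / 4 - a1 / 2)"
  "slice_op s a1 b1 a2 b2 a3 $ (2, 1) $ (2, 2) = of_real (- b1 / 2)"
  "slice_op s a1 b1 a2 b2 a3 $ (2, 2) $ (1, 1) = Complex ((a2 - a3) / 2) b2"
  "slice_op s a1 b1 a2 b2 a3 $ (2, 2) $ (1, 2) = of_real (- b1 / 2)"
  "slice_op s a1 b1 a2 b2 a3 $ (2, 2) $ (2, 1) = of_real (- b1 / 2)"
  "slice_op s a1 b1 a2 b2 a3 $ (2, 2) $ (2, 2) = of_real (1 / 4 - s + a1 / 2)"
  by (simp_all add: slice_op_def kron_def mat_def) (simp_all add: complex_eq_iff field_simps)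

lemma symmetric_liouville_space_iff:
  "\<rho> \<in> symmetric_liouville_space \<longleftrightarrow>
    (\<forall>i j k l. cnj (\<rho> $ (k, l) $ (i, j)) = \<rho> $ (i, j) $ (k, l)) \<and>
    (\<forall>i j k l. \<rho> $ (j, i) $ (k, l) = \<rho> $ (i, j) $ (l, k)) \<and>
    (\<Sum>i\<in>UNIV. \<Sum>j\<in>UNIV. \<rho> $ (i, j) $ (i, j)) = 1"
proof -
  have "hermitian \<rho> \<longleftrightarrow> (\<forall>i j k l. cnj (\<rho> $ (k, l) $ (i, j)) = \<rho> $ (i, j) $ (k, l))"
    unfolding hermitian_def vec_eq_iff adj_def split_paired_All vec_lambda_beta ..
  moreover have "swap_op ** \<rho> = \<rho> ** swap_op \<longleftrightarrow> (\<forall>i j k l. \<rho> $ (j, i) $ (k, l) = \<rho> $ (i, j) $ (l, k))"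
    unfolding vec_eq_iff swap_op_mult_left swap_op_mult_right split_paired_All swap_simp by blast
  moreover have "trace \<rho> = (\<Sum>i\<in>UNIV. \<Sum>j\<in>UNIV. \<rho> $ (i, j) $ (i, j))"
    by (simp add: trace_def sum_UNIV_prod)
  ultimately show ?thesis
    unfolding symmetric_liouville_space_def liouville_space_def mem_Collect_eq by (simp add: conj_ac)
qed

lemma slice_op_in_symmetric_liouville_space:
  "slice_op s a1 b1 a2 b2 a3 \<in> symmetric_liouville_space"
  unfolding symmetric_liouville_space_iff
  unfolding forall_2 sum_2 by (simp add: slice_op_nth) (simp add: complex_eq_iff)

lift_definition slice_state :: "real \<Rightarrow> real \<Rightarrow> real \<Rightarrow> real \<Rightarrow> real \<Rightarrow> real \<Rightarrow> sym_state" is slice_op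
  by (rule slice_op_in_symmetric_liouville_space)

lemma traceless_ptrace_slice_op_one:
  "traceless_ptrace (slice_op s a1 b1 a2 b2 a3) (mat 1) = pauli 0 0 s"
  unfolding vec_eq_iff traceless_ptrace_def partial_trace_def
  by (simp add: forall_2 sum_2 slice_op_nth mat_def trace_def) (simp add: complex_eq_iff field_simps)

text \<open>This identifies the action on Bloch vectors with the tridiagonal matrix S in the axis
  order z, x, y.\<close>

lemma traceless_ptrace_slice_op_pauli:
  "traceless_ptrace (slice_op s a1 b1 a2 b2 a3) (pauli x y z) =
    pauli (a2 * x + b2 * y + b1 * z) (b2 * x + a3 * y) (b1 * x + a1 * z)"
  unfolding vec_eq_iff traceless_ptrace_def partial_trace_def
  by (simp add: forall_2 sum_2 slice_op_nth mat_def trace_def) (simp add: complex_eq_iff field_simps)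

lemma trace_pauli_mult:
  "Re (trace (pauli x y z ** pauli x' y' z')) = 2 * (x * x' + y * y' + z * z')"
  by (simp add: matrix_matrix_mult_def trace_def sum_2 algebra_simps)

text \<open>The trace of three Pauli factors is 2i times the triple product of their vectors, whence
  the imaginary part.\<close>

lemma trace_pauli_mult3:
  "Im (trace (pauli x y z ** pauli x' y' z' ** pauli x'' y'' z'')) =
    2 * (x * (y' * z'' - z' * y'') + y * (z' * x'' - x' * z'') + z * (x' * y'' - y' * x''))"
  by (simp add: matrix_matrix_mult_def trace_def sum_2 algebra_simps)

lemma inv_fun_slice_op:
  "inv_fun 0 (slice_op s a1 b1 a2 b2 a3) = s^2"
  "inv_fun 1 (slice_op s a1 b1 a2 b2 a3) = s^2 * a1"
  "inv_fun 2 (slice_op s a1 b1 a2 b2 a3) = s^2 * (a1^2 + b1^2)"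
  "inv_fun 3 (slice_op s a1 b1 a2 b2 a3) = s^2 * (a1^3 + 2 * a1 * b1^2 + a2 * b1^2)"
  "inv_fun 4 (slice_op s a1 b1 a2 b2 a3) = s^3 * b1^2 * b2"
  "inv_fun 5 (slice_op s a1 b1 a2 b2 a3) = a1 + a2 + a3"
proof -
  let ?\<rho> = "slice_op s a1 b1 a2 b2 a3"
  have K: "krylov ?\<rho> 0 = pauli 0 0 s" "krylov ?\<rho> 1 = pauli (b1 * s) 0 (a1 * s)"
    "krylov ?\<rho> 2 = pauli (a2 * (b1 * s) + b1 * (a1 * s)) (b2 * (b1 * s)) (b1 * (b1 * s) + a1 * (a1 * s))"
    by (simp_all add: numeral_2_eq_2 traceless_ptrace_slice_op_one traceless_ptrace_slice_op_pauli)
  show "inv_fun 0 ?\<rho> = s^2" "inv_fun 1 ?\<rho> = s^2 * a1" "inv_fun 2 ?\<rho> = s^2 * (a1^2 + b1^2)"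
    "inv_fun 3 ?\<rho> = s^2 * (a1^3 + 2 * a1 * b1^2 + a2 * b1^2)"
    "inv_fun 4 ?\<rho> = s^3 * b1^2 * b2"
    unfolding inv_fun_def K trace_pauli_mult trace_pauli_mult3
    by (simp_all add: algebra_simps power2_eq_square power3_eq_cube)
  \<comment> \<open>\<open>swap_op\<close> is half the sum of the identity and the three squares
    \<open>kron A A\<close> of Pauli matrices, so its pairing with the state is 1/2 plus the trace
    of S.\<close>
  show "inv_fun 5 ?\<rho> = a1 + a2 + a3"
    by (simp add: inv_fun_def trace_def swap_op_mult_right sum_UNIV_prod sum_2 slice_op_nth field_simps)
qed

lemma unitary2_iff:
  "unitary (U :: qubit_op) \<longleftrightarrow> U ** adj U = mat 1"
  by (simp add: unitary_def matrix_left_right_inverse)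

text \<open>The eigenvalues are plus and minus the length of the vector, and \<open>s\<close> may be
  either of them; this leaves the sign of \<open>s\<close> free later.\<close>

lemma diagonalize_traceless_hermitian:
  assumes "s^2 = x^2 + y^2 + z^2"
  shows "\<exists>U. unitary U \<and> U ** pauli x y z ** adj U = pauli 0 0 s"
proof -
  define w where "w = Complex x (- y)"
  obtain \<alpha> \<beta> where ab: "\<alpha> \<noteq> 0 \<or> \<beta> \<noteq> 0" and
    ev: "of_real z * \<alpha> + w * \<beta> = of_real s * \<alpha>" "cnj w * \<alpha> - of_real z * \<beta> = of_real s * \<beta>"
  \<comment> \<open>The vector \<open>(w, s - z)\<close> is an eigenvector for \<open>s\<close>,
    because the squared modulus of \<open>w\<close> is \<open>s^2 - z^2\<close>. It vanishes exactly
    in the first case, where \<open>(1, 0)\<close> serves instead.\<close>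
  proof (cases "w = 0 \<and> s = z")
    case True
    then show thesis using that[of 1 0] by simp
  next
    case False
    have "cnj w * w = of_real (s^2 - z^2)"
      using assms by (simp add: w_def complex_eq_iff power2_eq_square)
    then have "cnj w * w - of_real z * of_real (s - z) = of_real s * of_real (s - z)"
      by (simp add: algebra_simps power2_eq_square)
    then show thesis
      using that[of w "of_real (s - z)"] False by (auto simp: algebra_simps)
  qed
  define r where "r = sqrt ((cmod \<alpha>)^2 + (cmod \<beta>)^2)"
  have r: "r > 0" "r^2 = (cmod \<alpha>)^2 + (cmod \<beta>)^2"
    using ab by (auto simp: r_def sum_power2_gt_zero_iff)
  define a b where "a = \<alpha> / of_real r" and "b = \<beta> / of_real r"
  have "(cmod a)^2 + (cmod b)^2 = 1"
    using r(1) by (simp add: a_def b_def norm_divide power_divide r(2)[symmetric] flip: add_divide_distrib)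
  then have n: "a * cnj a + b * cnj b = 1"
    by (metis complex_norm_square of_real_1 of_real_add)
  have e1: "of_real z * a + w * b = of_real s * a"
    and e2: "cnj w * a - of_real z * b = of_real s * b"
    using ev r by (simp_all add: a_def b_def divide_simps mult_ac)
  have e1': "of_real z * cnj a + cnj w * cnj b = of_real s * cnj a"
    and e2': "w * cnj a - of_real z * cnj b = of_real s * cnj b"
    using arg_cong[OF e1, of cnj] arg_cong[OF e2, of cnj] by simp_all
  \<comment> \<open>The rows are the conjugates of the unit eigenvector \<open>(a, b)\<close> and of
    its orthogonal companion \<open>(- cnj b, cnj a)\<close>, which belongs to
    \<open>- s\<close>.\<close>
  define U :: qubit_op where "U = vector [vector [cnj a, cnj b], vector [- b, a]]"
  have [simp]: "U $ 1 $ 1 = cnj a" "U $ 1 $ 2 = cnj b" "U $ 2 $ 1 = - b" "U $ 2 $ 2 = a"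
    by (simp_all add: U_def)
  have "U ** adj U = mat 1"
    using n by (simp add: vec_eq_iff forall_2 matrix_matrix_mult_def sum_2 adj_def mat_def algebra_simps)
  moreover have "U ** pauli x y z ** adj U = pauli 0 0 s"
  proof -
    have p: "pauli x y z $ 1 $ 2 = w" "pauli x y z $ 2 $ 1 = cnj w"
      by (simp_all add: w_def complex_eq_iff)
    define M where "M = pauli x y z ** adj U"
    have M: "M $ 1 $ 1 = of_real s * a" "M $ 2 $ 1 = of_real s * b"
      "M $ 1 $ 2 = of_real s * cnj b" "M $ 2 $ 2 = - (of_real s * cnj a)"
      using e1 e2 e1' e2'
      by (simp_all add: M_def matrix_matrix_mult_def sum_2 adj_def p algebra_simps del: pauli_nth(2,3))
    have "cnj a * (of_real s * a) + cnj b * (of_real s * b) = of_real s * (a * cnj a + b * cnj b)"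
      "- (b * (of_real s * cnj b)) - a * (of_real s * cnj a) = - (of_real s * (a * cnj a + b * cnj b))"
      by (simp_all add: algebra_simps)
    then have "U ** M = pauli 0 0 s"
      using n by (simp add: vec_eq_iff forall_2 matrix_matrix_mult_def sum_2 M complex_eq_iff)
    then show ?thesis
      by (simp add: M_def matrix_mul_assoc)
  qed
  ultimately show ?thesis
    by (auto simp: unitary2_iff)
qed

text \<open>With v on the z axis, the imaginary part in question is, up to a factor, the zy entry of
  S, the one entry that a tridiagonal S lacks. Hermiticity, swap symmetry and the trace then fix all
  entries of the state.\<close>

lemma eq_slice_op:
  assumes "\<rho> \<in> symmetric_liouville_space" "krylov \<rho> 0 = pauli 0 0 s" "Im (\<rho> $ (1, 1) $ (1, 2)) = 0"
  shows "\<exists>a1 a2 b2 a3. \<rho> = slice_op s a1 (2 * Re (\<rho> $ (1, 1) $ (1, 2))) a2 b2 a3"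
proof -
  have H: "cnj (\<rho> $ (k, l) $ (i, j)) = \<rho> $ (i, j) $ (k, l)"
    and S: "\<rho> $ (j, i) $ (k, l) = \<rho> $ (i, j) $ (l, k)"
    and T: "(\<Sum>i\<in>UNIV. \<Sum>j\<in>UNIV. \<rho> $ (i, j) $ (i, j)) = 1" for i j k l
    using assms(1) unfolding symmetric_liouville_space_iff by simp_all
  let ?R = "\<lambda>i j k l. \<rho> $ (i, j) $ (k, l)"
  have K: "krylov \<rho> 0 $ 1 $ 1 = of_real s" "krylov \<rho> 0 $ 1 $ 2 = 0"
    using assms(2) by (simp_all add: complex_eq_iff)
  have h: "Im (?R 1 1 1 1) = 0" "Im (?R 1 2 1 2) = 0" "Im (?R 2 2 2 2) = 0" "Im (?R 1 2 2 1) = 0"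
    using H[of 1 1 1 1] H[of 1 2 1 2] H[of 2 2 2 2] H[of 1 2 2 1] S[of 2 1 1 2]
    by (auto simp: complex_eq_iff)
  have s: "?R 1 1 2 1 = ?R 1 1 1 2" "?R 2 1 2 1 = ?R 1 2 1 2" "?R 2 1 1 2 = ?R 1 2 2 1"
    "?R 2 1 2 2 = ?R 1 2 2 2" "?R 2 1 1 1 = ?R 1 2 1 1" "?R 2 2 2 1 = ?R 2 2 1 2"
    by (metis S)+
  have c: "?R 1 2 1 1 = cnj (?R 1 1 1 2)" "?R 2 2 1 1 = cnj (?R 1 1 2 2)" "?R 2 2 1 2 = cnj (?R 1 2 2 2)"
    by (metis H)+
  have k: "?R 1 1 1 2 + ?R 1 2 2 2 = 0" "?R 1 1 1 1 - ?R 2 2 2 2 = 2 * of_real s"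
    using K s by (simp_all add: traceless_ptrace_def partial_trace_def sum_2 mat_def trace_def field_simps)
  have t: "?R 1 1 1 1 + 2 * ?R 1 2 1 2 + ?R 2 2 2 2 = 1"
    using T s by (simp add: sum_2 algebra_simps)
  have "\<rho> = slice_op s (1 / 2 - 2 * Re (?R 1 2 1 2)) (2 * Re (\<rho> $ (1, 1) $ (1, 2)))
      (Re (?R 1 2 2 1) + Re (?R 1 1 2 2)) (- Im (?R 1 1 2 2)) (Re (?R 1 2 2 1) - Re (?R 1 1 2 2))"
    using k t h assms(3)
    unfolding two_qubit_op_eq_iff forall_2 slice_op_nth s c complex_eq_iff
    by (simp add: field_simps)
  then show ?thesis by blast
qed

text \<open>A rotation about the z axis keeps v and turns the pair of zx and zy entries of S, so zy
  can be made zero and zx given the sign \<open>e\<close>.\<close>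

lemma rotate_to_slice:
  assumes "\<rho> \<in> symmetric_liouville_space" "krylov \<rho> 0 = pauli 0 0 s" "e \<in> {1, -1}"
  shows "\<exists>U a1 b1 a2 b2 a3. unitary U \<and>
    kron U U ** \<rho> ** adj (kron U U) = slice_op s a1 b1 a2 b2 a3 \<and> e * b1 \<ge> 0"
proof -
  define \<kappa> where "\<kappa> = \<rho> $ (1, 1) $ (1, 2)"
  \<comment> \<open>The phase \<open>u\<close> turns \<open>\<kappa>\<close> onto the real axis, on
    the side given by \<open>e\<close>.\<close>
  define u where "u = (if \<kappa> = 0 then 1 else of_real e * cnj (sgn \<kappa>))"
  have u: "u * cnj u = 1" "u * \<kappa> = of_real (e * cmod \<kappa>)"
  proof -
    have "cmod u = 1"
      using assms(3) by (auto simp: u_def norm_mult norm_sgn)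
    then show "u * cnj u = 1" by (simp add: complex_mult_cnj cmod_def complex_eq_iff)
    show "u * \<kappa> = of_real (e * cmod \<kappa>)"
      using complex_norm_square[of \<kappa>] by (simp add: u_def sgn_eq power2_eq_square field_simps)
  qed
  define U :: qubit_op where "U = vector [vector [u, 0], vector [0, 1]]"
  have [simp]: "U $ 1 $ 1 = u" "U $ 1 $ 2 = 0" "U $ 2 $ 1 = 0" "U $ 2 $ 2 = 1"
    by (simp_all add: U_def)
  have U: "unitary U"
    using u by (simp add: unitary2_iff vec_eq_iff forall_2 matrix_matrix_mult_def sum_2 adj_def mat_def)
  define \<sigma> where "\<sigma> = kron U U ** \<rho> ** adj (kron U U)"
  have "\<sigma> $ (1, 1) $ (1, 2) = u * (u * cnj u) * \<kappa>"
    by (simp add: \<sigma>_def matrix_matrix_mult_def sum_UNIV_prod sum_2 kron_def adj_def \<kappa>_def)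
  then have "\<sigma> $ (1, 1) $ (1, 2) = of_real (e * cmod \<kappa>)"
    by (simp add: u)
  moreover have "krylov \<sigma> 0 = pauli 0 0 s"
    unfolding \<sigma>_def krylov_conj[OF U] assms(2)
    using arg_cong[OF u(1), of "\<lambda>c. of_real s * c"]
    by (simp add: vec_eq_iff forall_2 matrix_matrix_mult_def sum_2 adj_def Complex_eq_0 mult_ac)
  moreover have "\<sigma> \<in> symmetric_liouville_space"
    unfolding \<sigma>_def by (rule conj_in_symmetric_liouville_space[OF U assms(1)])
  ultimately obtain a1 a2 b2 a3 where "\<sigma> = slice_op s a1 (2 * (e * cmod \<kappa>)) a2 b2 a3"
    using eq_slice_op[of \<sigma> s] by auto
  moreover have "e * (2 * (e * cmod \<kappa>)) \<ge> 0"
    using assms(3) by auto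
  ultimately show ?thesis
    using U unfolding \<sigma>_def by blast
qed

lemma krylov_0_eq_pauli:
  assumes "\<rho> \<in> symmetric_liouville_space"
  shows "\<exists>x y z. krylov \<rho> 0 = pauli x y z"
proof -
  have H: "cnj (\<rho> $ (k, l) $ (i, j)) = \<rho> $ (i, j) $ (k, l)" for i j k l
    using assms unfolding symmetric_liouville_space_iff by simp
  let ?K = "krylov \<rho> 0"
  have "?K $ 2 $ 1 = cnj (?K $ 1 $ 2)"
    using H[of 1 1 2 1] H[of 1 2 2 2]
    by (simp add: traceless_ptrace_def partial_trace_def sum_2 mat_def)
  moreover have "?K $ 2 $ 2 = - ?K $ 1 $ 1"
    by (simp add: traceless_ptrace_def sum_2 mat_def trace_def field_simps)
  moreover have "Im (?K $ 1 $ 1) = 0"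
    using H[of 1 1 1 1] H[of 1 2 1 2] H[of 2 1 2 1] H[of 2 2 2 2]
    by (simp add: traceless_ptrace_def partial_trace_def sum_2 mat_def trace_def complex_eq_iff)
  ultimately have "?K = pauli (Re (?K $ 2 $ 1)) (Im (?K $ 2 $ 1)) (Re (?K $ 1 $ 1))"
    unfolding vec_eq_iff forall_2 by (simp add: complex_eq_iff del: krylov.simps)
  then show ?thesis by blast
qed

section \<open>Invariants determine the normal form\<close>

lift_definition inv_poly :: "nat \<Rightarrow> state_poly" is "\<lambda>i x. inv_fun i (Rep_sym_state x)"
  using real_polynomial_inv_fun by blast

abbreviation inv_at :: "nat \<Rightarrow> sym_state \<Rightarrow> real" where
  "inv_at i x \<equiv> poly_fun (inv_poly i) x"

lemma inv_at_act: "inv_at i (act g x) = inv_at i x"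
  using Rep_unitary2[of g] by (simp add: inv_poly.rep_eq act.rep_eq inv_fun_conj)

lemma inv_at_slice_state:
  "inv_at 0 (slice_state s a1 b1 a2 b2 a3) = s^2"
  "inv_at (Suc 0) (slice_state s a1 b1 a2 b2 a3) = s^2 * a1"
  "inv_at 2 (slice_state s a1 b1 a2 b2 a3) = s^2 * (a1^2 + b1^2)"
  "inv_at 3 (slice_state s a1 b1 a2 b2 a3) = s^2 * (a1^3 + 2 * a1 * b1^2 + a2 * b1^2)"
  "inv_at 4 (slice_state s a1 b1 a2 b2 a3) = s^3 * b1^2 * b2"
  "inv_at 5 (slice_state s a1 b1 a2 b2 a3) = a1 + a2 + a3"
  using inv_fun_slice_op by (simp_all add: inv_poly.rep_eq slice_state.rep_eq)

text \<open>Two rotations are composed: one takes v to its axis with the prescribed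
  \<open>s\<close>, the other turns about that axis and prescribes the sign of
  \<open>b1\<close>.\<close>

lemma act_to_slice_state:
  assumes "s^2 = inv_at 0 x" "e \<in> {1, -1}"
  shows "\<exists>g a1 b1 a2 b2 a3. act g x = slice_state s a1 b1 a2 b2 a3 \<and> e * b1 \<ge> 0"
proof -
  let ?\<rho> = "Rep_sym_state x"
  obtain u v w where K: "krylov ?\<rho> 0 = pauli u v w"
    using krylov_0_eq_pauli[OF Rep_sym_state] by blast
  have "s^2 = u^2 + v^2 + w^2"
    using assms(1) by (simp add: inv_poly.rep_eq inv_fun_def K trace_pauli_mult power2_eq_square
        del: krylov.simps)
  then obtain U where U: "unitary U" "U ** pauli u v w ** adj U = pauli 0 0 s"
    using diagonalize_traceless_hermitian by blast
  have "krylov (kron U U ** ?\<rho> ** adj (kron U U)) 0 = pauli 0 0 s"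
    by (simp only: krylov_conj[OF U(1)] K U(2))
  then obtain W a1 b1 a2 b2 a3 where W: "unitary W" "e * b1 \<ge> 0"
    "kron W W ** (kron U U ** ?\<rho> ** adj (kron U U)) ** adj (kron W W) = slice_op s a1 b1 a2 b2 a3"
    using rotate_to_slice[OF conj_in_symmetric_liouville_space[OF U(1) Rep_sym_state] _ assms(2)]
    by blast
  have WU: "unitary (W ** U)"
  proof -
    have "W ** U ** adj (W ** U) = W ** (U ** adj U) ** adj W"
      by (simp add: adj_mult matrix_mul_assoc)
    then show ?thesis
      using U(1) W(1) by (simp add: unitary2_iff)
  qed
  have "kron (W ** U) (W ** U) ** ?\<rho> ** adj (kron (W ** U) (W ** U)) = slice_op s a1 b1 a2 b2 a3"
    using W(3) by (simp add: adj_mult matrix_mul_assoc flip: kron_mult)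
  then have "act (Abs_unitary2 (W ** U)) x = slice_state s a1 b1 a2 b2 a3"
    using WU by (simp add: act.rep_eq slice_state.rep_eq Abs_unitary2_inverse flip: Rep_sym_state_inject)
  then show ?thesis using W(2) by blast
qed

text \<open>The second quantity is the Gram determinant of v and S v, so these vectors are linearly
  independent; on the slice this means that \<open>s\<close> and \<open>b1\<close> are
  nonzero.\<close>

definition generic :: "sym_state \<Rightarrow> bool" where
  "generic x \<longleftrightarrow> inv_at 0 x \<noteq> 0 \<and> inv_at 0 x * inv_at 2 x - (inv_at 1 x)\<^sup>2 \<noteq> 0"

text \<open>This and the next formulas solve \<open>inv_at_slice_state\<close> successively for the
  slice parameters.\<close>

definition slice_a1 :: "sym_state \<Rightarrow> real" where
  "slice_a1 x = inv_at 1 x / inv_at 0 x"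

definition slice_b1_sq :: "sym_state \<Rightarrow> real" where
  "slice_b1_sq x = (inv_at 0 x * inv_at 2 x - (inv_at 1 x)\<^sup>2) / (inv_at 0 x)\<^sup>2"

definition slice_a2 :: "sym_state \<Rightarrow> real" where
  "slice_a2 x = (inv_at 3 x / inv_at 0 x - slice_a1 x ^ 3 - 2 * slice_a1 x * slice_b1_sq x) / slice_b1_sq x"

text \<open>Since \<open>det (v, S v, S\<^sup>2 v) = s\<^sup>3 b1\<^sup>2 b2\<close>, only the quotient \<open>b2 / s\<close> is rational in the invariants.\<close>

definition slice_b2_div :: "sym_state \<Rightarrow> real" where
  "slice_b2_div x = inv_at 4 x / ((inv_at 0 x)\<^sup>2 * slice_b1_sq x)"

definition slice_a3 :: "sym_state \<Rightarrow> real" where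
  "slice_a3 x = inv_at 5 x - slice_a1 x - slice_a2 x"

text \<open>The invariants determine only the squares of \<open>s\<close> and \<open>b\<close>,
  which therefore remain arguments; the entry b2 changes sign with \<open>s\<close>.\<close>

definition normal_form :: "sym_state \<Rightarrow> real \<Rightarrow> real \<Rightarrow> sym_state" where
  "normal_form x s b = slice_state s (slice_a1 x) b (slice_a2 x) (s * slice_b2_div x) (slice_a3 x)"

text \<open>Invariants are constant on orbits, so their values at \<open>x\<close> can be computed
  at the slice point. Genericity makes \<open>s\<close> and \<open>b1\<close> nonzero, which
  justifies the divisions.\<close>

lemma slice_params:
  assumes "generic x" "act g x = slice_state s a1 b1 a2 b2 a3"
  shows "slice_b1_sq x = b1^2" "act g x = normal_form x s b1"
proof -
  have m: "inv_at 0 x = s^2" "inv_at (Suc 0) x = s^2 * a1" "inv_at 2 x = s^2 * (a1^2 + b1^2)"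
    "inv_at 3 x = s^2 * (a1^3 + 2 * a1 * b1^2 + a2 * b1^2)" "inv_at 4 x = s^3 * b1^2 * b2"
    "inv_at 5 x = a1 + a2 + a3"
    using inv_at_act[of _ g x, symmetric] by (simp_all add: assms(2) inv_at_slice_state)
  have D: "inv_at 0 x * inv_at 2 x - (inv_at 1 x)\<^sup>2 = s^4 * b1^2"
    by (simp add: m algebra_simps power2_eq_square power4_eq_xxxx)
  have "s \<noteq> 0" "b1 \<noteq> 0"
    using assms(1) unfolding generic_def D by (auto simp: m)
  have a1: "slice_a1 x = a1"
    using \<open>s \<noteq> 0\<close> by (simp add: slice_a1_def m)
  show b1: "slice_b1_sq x = b1^2"
    using \<open>s \<noteq> 0\<close> unfolding slice_b1_sq_def D by (simp add: m)
  have a2: "slice_a2 x = a2"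
    using \<open>s \<noteq> 0\<close> \<open>b1 \<noteq> 0\<close> by (simp add: slice_a2_def m a1 b1)
  have "s * slice_b2_div x = b2"
    using \<open>s \<noteq> 0\<close> \<open>b1 \<noteq> 0\<close> by (simp add: slice_b2_div_def m b1 power2_eq_square power3_eq_cube)
  then show "act g x = normal_form x s b1"
    by (simp add: normal_form_def assms(2) a1 a2 slice_a3_def m)
qed

text \<open>The orbit meets the slice with the chosen sign of \<open>s\<close> and the chosen sign
  of \<open>b1\<close>; since \<open>b1^2 = b^2\<close>, the sign forces
  \<open>b1 = b\<close>.\<close>

lemma act_to_normal_form:
  assumes "generic x" "s^2 = inv_at 0 x" "b^2 = slice_b1_sq x"
  shows "\<exists>g. act g x = normal_form x s b"
proof -
  define e :: real where "e = (if b \<ge> 0 then 1 else -1)"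
  have "e \<in> {1, -1}" by (simp add: e_def)
  then obtain g a1 b1 a2 b2 a3 where g: "act g x = slice_state s a1 b1 a2 b2 a3" "e * b1 \<ge> 0"
    using act_to_slice_state[OF assms(2)] by blast
  have "b1^2 = b^2" "act g x = normal_form x s b1"
    using slice_params[OF assms(1) g(1)] assms(3) by simp_all
  moreover have "b1 = b"
    using \<open>b1^2 = b^2\<close> g(2) by (auto simp: e_def power2_eq_iff split: if_splits)
  ultimately show ?thesis by blast
qed

text \<open>The squared length of v and the square of a real slice parameter are nonnegative; hence
  real \<open>s\<close> and \<open>b\<close> exist for the normal form.\<close>

lemma generic_pos:
  assumes "generic x"
  shows "inv_at 0 x > 0" "slice_b1_sq x > 0"
proof -
  obtain u v w where K: "krylov (Rep_sym_state x) 0 = pauli u v w"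
    using krylov_0_eq_pauli[OF Rep_sym_state] by blast
  have "inv_at 0 x \<ge> 0"
    by (simp add: inv_poly.rep_eq inv_fun_def K trace_pauli_mult del: krylov.simps)
  then show "inv_at 0 x > 0"
    using assms by (simp add: generic_def order_less_le)
  then obtain g a1 b1 a2 b2 a3 where "act g x = slice_state (sqrt (inv_at 0 x)) a1 b1 a2 b2 a3"
    using act_to_slice_state[of "sqrt (inv_at 0 x)" x 1] by auto
  then have "slice_b1_sq x \<ge> 0"
    using slice_params(1)[OF assms] by simp
  moreover have "slice_b1_sq x \<noteq> 0"
    using assms by (simp add: slice_b1_sq_def generic_def)
  ultimately show "slice_b1_sq x > 0" by simp
qed

section \<open>Functions rational in the invariants\<close>

lemma zero_in_field_generated: "0 \<in> field_generated S"
  using field_generated.diff[OF field_generated.one field_generated.one] by simp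

lemma uminus_in_field_generated: "x \<in> field_generated S \<Longrightarrow> - x \<in> field_generated S"
  using field_generated.diff[OF zero_in_field_generated] by simp

lemma add_in_field_generated:
  "x \<in> field_generated S \<Longrightarrow> y \<in> field_generated S \<Longrightarrow> x + y \<in> field_generated S"
  using field_generated.diff[OF _ uminus_in_field_generated] by simp

lemma divide_in_field_generated:
  "x \<in> field_generated S \<Longrightarrow> y \<in> field_generated S \<Longrightarrow> x / y \<in> field_generated S"
  by (simp add: divide_inverse field_generated.mult field_generated.inverse)

definition inv_field :: "state_rat set" where
  "inv_field = field_generated (range const_rat \<union> (\<lambda>i. Fract (inv_poly i) 1) ` {..<6})"

lemma const_in_inv_field: "Fract (const_poly c) 1 \<in> inv_field"
  unfolding inv_field_def by (rule field_generated.incl) (auto simp: const_rat_def)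

lemma inv_poly_in_inv_field: "i < 6 \<Longrightarrow> Fract (inv_poly i) 1 \<in> inv_field"
  unfolding inv_field_def by (rule field_generated.incl) auto

lemma add_in_inv_field:
  assumes "Fract u 1 \<in> inv_field" "Fract v 1 \<in> inv_field"
  shows "Fract (u + v) 1 \<in> inv_field"
  using add_in_field_generated[OF assms[unfolded inv_field_def]] by (simp add: inv_field_def)

lemma mult_in_inv_field:
  assumes "Fract u 1 \<in> inv_field" "Fract v 1 \<in> inv_field"
  shows "Fract (u * v) 1 \<in> inv_field"
  using field_generated.mult[OF assms[unfolded inv_field_def]] by (simp add: inv_field_def)

lemma one_in_inv_field: "Fract 1 1 \<in> inv_field"
  unfolding inv_field_def One_fract_def[symmetric] by (rule field_generated.one)

text \<open>Elements of the fraction field are not functions, so rationality is stated through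
  values at generic states. Denominators without generic zeros make the class closed under inverses
  of functions that vanish at no generic state.\<close>

definition inv_rational :: "(sym_state \<Rightarrow> real) \<Rightarrow> bool" where
  "inv_rational h \<longleftrightarrow> (\<exists>u w. Fract u 1 \<in> inv_field \<and> Fract w 1 \<in> inv_field \<and>
    (\<forall>x. generic x \<longrightarrow> poly_fun w x \<noteq> 0 \<and> h x = poly_fun u x / poly_fun w x))"

lemma inv_rational_of_poly:
  assumes "Fract u 1 \<in> inv_field"
  shows "inv_rational (poly_fun u)"
  unfolding inv_rational_def
  by (rule exI[of _ u], rule exI[of _ 1]) (simp add: assms one_in_inv_field one_state_poly.rep_eq)

lemma inv_rational_const: "inv_rational (\<lambda>_. c)"
  using inv_rational_of_poly[OF const_in_inv_field[of c]] by (simp add: const_poly.rep_eq)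

lemma inv_rational_inv_at: "i < 6 \<Longrightarrow> inv_rational (inv_at i)"
  by (rule inv_rational_of_poly[OF inv_poly_in_inv_field])

lemma inv_rational_add:
  assumes "inv_rational h" "inv_rational k"
  shows "inv_rational (\<lambda>x. h x + k x)"
proof -
  obtain u w where u: "Fract u 1 \<in> inv_field" "Fract w 1 \<in> inv_field"
    "\<And>x. generic x \<Longrightarrow> poly_fun w x \<noteq> 0" "\<And>x. generic x \<Longrightarrow> h x = poly_fun u x / poly_fun w x"
    using assms(1) unfolding inv_rational_def by blast
  obtain v z where v: "Fract v 1 \<in> inv_field" "Fract z 1 \<in> inv_field"
    "\<And>x. generic x \<Longrightarrow> poly_fun z x \<noteq> 0" "\<And>x. generic x \<Longrightarrow> k x = poly_fun v x / poly_fun z x"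
    using assms(2) unfolding inv_rational_def by blast
  show ?thesis
    unfolding inv_rational_def
    using u v by (intro exI[of _ "u * z + v * w"] exI[of _ "w * z"])
      (simp add: mult_in_inv_field add_in_inv_field times_state_poly.rep_eq plus_state_poly.rep_eq
        add_frac_eq)
qed

lemma inv_rational_mult:
  assumes "inv_rational h" "inv_rational k"
  shows "inv_rational (\<lambda>x. h x * k x)"
proof -
  obtain u w where u: "Fract u 1 \<in> inv_field" "Fract w 1 \<in> inv_field"
    "\<And>x. generic x \<Longrightarrow> poly_fun w x \<noteq> 0" "\<And>x. generic x \<Longrightarrow> h x = poly_fun u x / poly_fun w x"
    using assms(1) unfolding inv_rational_def by blast
  obtain v z where v: "Fract v 1 \<in> inv_field" "Fract z 1 \<in> inv_field"
    "\<And>x. generic x \<Longrightarrow> poly_fun z x \<noteq> 0" "\<And>x. generic x \<Longrightarrow> k x = poly_fun v x / poly_fun z x"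
    using assms(2) unfolding inv_rational_def by blast
  show ?thesis
    unfolding inv_rational_def
    using u v by (intro exI[of _ "u * v"] exI[of _ "w * z"])
      (simp add: mult_in_inv_field times_state_poly.rep_eq)
qed

lemma inv_rational_inverse:
  assumes "inv_rational h" "\<And>x. generic x \<Longrightarrow> h x \<noteq> 0"
  shows "inv_rational (\<lambda>x. inverse (h x))"
proof -
  obtain u w where u: "Fract u 1 \<in> inv_field" "Fract w 1 \<in> inv_field"
    "\<And>x. generic x \<Longrightarrow> poly_fun w x \<noteq> 0" "\<And>x. generic x \<Longrightarrow> h x = poly_fun u x / poly_fun w x"
    using assms(1) unfolding inv_rational_def by blast
  moreover have "poly_fun u x \<noteq> 0" if "generic x" for x
    using assms(2)[OF that] u(4)[OF that] by auto
  ultimately show ?thesis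
    unfolding inv_rational_def by (intro exI[of _ w] exI[of _ u]) simp
qed

lemma inv_rational_divide:
  assumes "inv_rational h" "inv_rational k" "\<And>x. generic x \<Longrightarrow> k x \<noteq> 0"
  shows "inv_rational (\<lambda>x. h x / k x)"
  using inv_rational_mult[OF assms(1) inv_rational_inverse[OF assms(2,3)]]
  by (simp add: divide_inverse)

lemma inv_rational_diff:
  assumes "inv_rational h" "inv_rational k"
  shows "inv_rational (\<lambda>x. h x - k x)"
  using inv_rational_add[OF assms(1) inv_rational_mult[OF inv_rational_const[of "-1"] assms(2)]]
  by simp

lemma inv_rational_power: "inv_rational h \<Longrightarrow> inv_rational (\<lambda>x. h x ^ n)"
  by (induction n) (simp_all add: inv_rational_const inv_rational_mult)

lemmas inv_rational_intros = inv_rational_const inv_rational_inv_at inv_rational_add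
  inv_rational_mult inv_rational_diff inv_rational_power inv_rational_divide

lemma inv_rational_slice_a1: "inv_rational slice_a1"
  unfolding slice_a1_def[abs_def] by (intro inv_rational_intros) (simp_all add: generic_def)

lemma inv_rational_slice_b1_sq: "inv_rational slice_b1_sq"
  unfolding slice_b1_sq_def[abs_def] by (intro inv_rational_intros) (simp_all add: generic_def)

lemma inv_rational_slice_a2: "inv_rational slice_a2"
  unfolding slice_a2_def[abs_def]
  by (intro inv_rational_intros inv_rational_slice_a1 inv_rational_slice_b1_sq)
    (use generic_pos in \<open>auto simp: generic_def less_le\<close>)

lemma inv_rational_slice_b2_div: "inv_rational slice_b2_div"
  unfolding slice_b2_div_def[abs_def]
  by (intro inv_rational_intros inv_rational_slice_b1_sq)
    (use generic_pos in \<open>auto simp: generic_def less_le\<close>)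

lemma inv_rational_slice_a3: "inv_rational slice_a3"
  unfolding slice_a3_def[abs_def]
  by (intro inv_rational_intros inv_rational_slice_a1 inv_rational_slice_a2) simp_all

text \<open>
  On the slice a polynomial is reduced modulo \<open>s\<^sup>2\<close> and \<open>b1\<^sup>2\<close>, both of which are rational
  in the invariants.
\<close>

lemma poly_on_normal_form:
  assumes "real_polynomial_function P"
  shows "\<exists>h0 h1 h2 h3. inv_rational h0 \<and> inv_rational h1 \<and> inv_rational h2 \<and> inv_rational h3 \<and>
    (\<forall>x s b. generic x \<longrightarrow> s^2 = inv_at 0 x \<longrightarrow> b^2 = slice_b1_sq x \<longrightarrow>
      P (Rep_sym_state (normal_form x s b)) = h0 x + b * h1 x + s * h2 x + s * b * h3 x)"
  using assms
proof induction
  case (linear f)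
  then interpret bounded_linear f .
  let ?k = "\<lambda>A B. (1 / 2) *\<^sub>R (kron A B + kron B A)"
  let ?h = "\<lambda>A. (1 / 2) *\<^sub>R kron A A"
  show ?case
    \<comment> \<open>A slice operator is a real combination of fixed operators. Its b2 term carries
      the factor \<open>s\<close> and so joins the coefficient of \<open>s\<close>.\<close>
    by (rule exI[of _ "\<lambda>x. f (mat (1 / 4)) + slice_a1 x * f (?h pauli_z) +
          slice_a2 x * f (?h pauli_x) + slice_a3 x * f (?h pauli_y)"],
        rule exI[of _ "\<lambda>_. f (?k pauli_z pauli_x)"],
        rule exI[of _ "\<lambda>x. f (?k pauli_z (mat 1)) + slice_b2_div x * f (?k pauli_x pauli_y)"],
        rule exI[of _ "\<lambda>_. 0"])
      (simp add: inv_rational_intros inv_rational_slice_a1 inv_rational_slice_a2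
        inv_rational_slice_a3 inv_rational_slice_b2_div normal_form_def slice_state.rep_eq
        slice_op_def add scale algebra_simps del: scaleR_scaleR)
next
  case (const c)
  show ?case
    by (rule exI[of _ "\<lambda>_. c"], rule exI[of _ "\<lambda>_. 0"], rule exI[of _ "\<lambda>_. 0"],
        rule exI[of _ "\<lambda>_. 0"]) (simp add: inv_rational_const)
next
  case (add f g)
  from add.IH(1) obtain h0 h1 h2 h3 where h: "inv_rational h0" "inv_rational h1" "inv_rational h2"
    "inv_rational h3" "\<And>x s b. generic x \<Longrightarrow> s^2 = inv_at 0 x \<Longrightarrow> b^2 = slice_b1_sq x \<Longrightarrow>
      f (Rep_sym_state (normal_form x s b)) = h0 x + b * h1 x + s * h2 x + s * b * h3 x" by blast
  from add.IH(2) obtain k0 k1 k2 k3 where k: "inv_rational k0" "inv_rational k1" "inv_rational k2"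
    "inv_rational k3" "\<And>x s b. generic x \<Longrightarrow> s^2 = inv_at 0 x \<Longrightarrow> b^2 = slice_b1_sq x \<Longrightarrow>
      g (Rep_sym_state (normal_form x s b)) = k0 x + b * k1 x + s * k2 x + s * b * k3 x" by blast
  show ?case
    by (rule exI[of _ "\<lambda>x. h0 x + k0 x"], rule exI[of _ "\<lambda>x. h1 x + k1 x"],
        rule exI[of _ "\<lambda>x. h2 x + k2 x"], rule exI[of _ "\<lambda>x. h3 x + k3 x"])
      (simp add: h k inv_rational_add algebra_simps)
next
  case (mult f g)
  from mult.IH(1) obtain h0 h1 h2 h3 where h: "inv_rational h0" "inv_rational h1" "inv_rational h2"
    "inv_rational h3" "\<And>x s b. generic x \<Longrightarrow> s^2 = inv_at 0 x \<Longrightarrow> b^2 = slice_b1_sq x \<Longrightarrow>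
      f (Rep_sym_state (normal_form x s b)) = h0 x + b * h1 x + s * h2 x + s * b * h3 x" by blast
  from mult.IH(2) obtain k0 k1 k2 k3 where k: "inv_rational k0" "inv_rational k1" "inv_rational k2"
    "inv_rational k3" "\<And>x s b. generic x \<Longrightarrow> s^2 = inv_at 0 x \<Longrightarrow> b^2 = slice_b1_sq x \<Longrightarrow>
      g (Rep_sym_state (normal_form x s b)) = k0 x + b * k1 x + s * k2 x + s * b * k3 x" by blast
  let ?m = "inv_at 0" and ?B = slice_b1_sq
  \<comment> \<open>These are the coefficients of the product in 1, \<open>b\<close>,
    \<open>s\<close>, \<open>s * b\<close> after replacing \<open>s^2\<close> by \<open>?m x\<close>
    and \<open>b^2\<close> by \<open>?B x\<close>.\<close>
  let ?l0 = "\<lambda>x. h0 x * k0 x + ?B x * (h1 x * k1 x) + ?m x * (h2 x * k2 x) + ?m x * (?B x * (h3 x * k3 x))"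
  let ?l1 = "\<lambda>x. h0 x * k1 x + h1 x * k0 x + ?m x * (h2 x * k3 x + h3 x * k2 x)"
  let ?l2 = "\<lambda>x. h0 x * k2 x + h2 x * k0 x + ?B x * (h1 x * k3 x + h3 x * k1 x)"
  let ?l3 = "\<lambda>x. h0 x * k3 x + h3 x * k0 x + h1 x * k2 x + h2 x * k1 x"
  have "f (Rep_sym_state (normal_form x s b)) * g (Rep_sym_state (normal_form x s b)) =
      ?l0 x + b * ?l1 x + s * ?l2 x + s * b * ?l3 x"
    if "generic x" "s^2 = ?m x" "b^2 = ?B x" for x s b
    unfolding h(5)[OF that] k(5)[OF that] that(2,3)[symmetric]
    by (simp add: power2_eq_square algebra_simps)
  moreover have "inv_rational ?l0" "inv_rational ?l1" "inv_rational ?l2" "inv_rational ?l3"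
    by (simp_all add: h k inv_rational_add inv_rational_mult inv_rational_inv_at inv_rational_slice_b1_sq)
  ultimately show ?case by blast
qed

section \<open>The field of invariants\<close>

definition generic_poly :: state_poly where
  "generic_poly = inv_poly 0 * (inv_poly 0 * inv_poly 2 - inv_poly 1 * inv_poly 1)"

lemma generic_poly_eq_0_iff: "poly_fun generic_poly x = 0 \<longleftrightarrow> \<not> generic x"
  by (auto simp: generic_poly_def generic_def times_state_poly.rep_eq minus_state_poly.rep_eq
      power2_eq_square)

lemma state_poly_nonzero_iff: "p \<noteq> 0 \<longleftrightarrow> (\<exists>x. poly_fun p x \<noteq> 0)"
  by (simp add: state_poly_eq_iff zero_state_poly.rep_eq)

lemma generic_poly_nonzero: "generic_poly \<noteq> 0"
proof -
  \<comment> \<open>At this state v and S v are orthogonal unit vectors.\<close>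
  have "generic (slice_state 1 0 1 0 0 0)"
    by (simp add: generic_def inv_at_slice_state)
  then show ?thesis
    unfolding state_poly_nonzero_iff generic_poly_eq_0_iff by blast
qed

text \<open>The difference times \<open>generic_poly\<close> vanishes everywhere, and polynomial
  functions form an integral domain.\<close>

lemma state_poly_eqI_generic:
  assumes "\<And>x. generic x \<Longrightarrow> poly_fun p x = poly_fun q x"
  shows "p = q"
proof -
  have "poly_fun ((p - q) * generic_poly) x = 0" for x
    using assms generic_poly_eq_0_iff[of x]
    by (auto simp: times_state_poly.rep_eq minus_state_poly.rep_eq)
  then have "(p - q) * generic_poly = 0"
    using state_poly_nonzero_iff by blast
  then show ?thesis
    using generic_poly_nonzero by simp
qed

text \<open>Clearing the denominators of \<open>h\<close> and \<open>k\<close> gives a polynomial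
  identity at generic states, hence everywhere. The point \<open>x0\<close> shows that the numerator
  of \<open>k\<close> is not the zero polynomial.\<close>

lemma Fract_in_inv_field:
  assumes h: "inv_rational h" and k: "inv_rational k"
    and pq: "\<And>x. generic x \<Longrightarrow> poly_fun p x * k x = poly_fun q x * h x"
    and x0: "generic x0" "k x0 \<noteq> 0" and "q \<noteq> 0"
  shows "Fract p q \<in> inv_field"
proof -
  obtain u w where u: "Fract u 1 \<in> inv_field" "Fract w 1 \<in> inv_field"
    "\<And>x. generic x \<Longrightarrow> poly_fun w x \<noteq> 0" "\<And>x. generic x \<Longrightarrow> h x = poly_fun u x / poly_fun w x"
    using h unfolding inv_rational_def by blast
  obtain v z where v: "Fract v 1 \<in> inv_field" "Fract z 1 \<in> inv_field"
    "\<And>x. generic x \<Longrightarrow> poly_fun z x \<noteq> 0" "\<And>x. generic x \<Longrightarrow> k x = poly_fun v x / poly_fun z x"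
    using k unfolding inv_rational_def by blast
  have nz: "v \<noteq> 0" "w \<noteq> 0"
    using x0 u(3)[OF x0(1)] v(4)[OF x0(1)] unfolding state_poly_nonzero_iff by auto
  have "p * (v * w) = (u * z) * q"
  proof (rule state_poly_eqI_generic)
    fix x assume "generic x"
    then show "poly_fun (p * (v * w)) x = poly_fun (u * z * q) x"
      using pq[of x] u(3,4)[of x] v(3,4)[of x] by (simp add: times_state_poly.rep_eq field_simps)
  qed
  then have "Fract p q = Fract (u * z) (v * w)"
    using nz \<open>q \<noteq> 0\<close> by (simp add: eq_fract)
  also have "\<dots> = Fract (u * z) 1 / Fract (v * w) 1"
    by simp
  also have "\<dots> \<in> inv_field"
    using mult_in_inv_field[OF u(1) v(2)] mult_in_inv_field[OF v(1) u(2)]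
    unfolding inv_field_def by (rule divide_in_field_generated)
  finally show ?thesis .
qed

lemma poly_fun_on_normal_form:
  "\<exists>h0 h1 h2 h3. inv_rational h0 \<and> inv_rational h1 \<and> inv_rational h2 \<and> inv_rational h3 \<and>
    (\<forall>x s b. generic x \<longrightarrow> s^2 = inv_at 0 x \<longrightarrow> b^2 = slice_b1_sq x \<longrightarrow>
      poly_fun p (normal_form x s b) = h0 x + b * h1 x + s * h2 x + s * b * h3 x)"
proof -
  obtain P where "real_polynomial_function P" "\<And>x. poly_fun p x = P (Rep_sym_state x)"
    using poly_fun[of p] by auto
  then show ?thesis
    using poly_on_normal_form[of P] by simp
qed

text \<open>
  All four sign choices for \<open>(s, b1)\<close> lie in the same orbit; this separates the coefficients of the
  reduced form.
\<close>

lemma sign_independence: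
  fixes s b :: real
  assumes "s \<noteq> 0" "b \<noteq> 0"
    and "\<And>s' b'. s'^2 = s^2 \<Longrightarrow> b'^2 = b^2 \<Longrightarrow> c0 + b' * c1 + s' * c2 + s' * b' * c3 = 0"
  shows "c0 = 0 \<and> c1 = 0 \<and> c2 = 0 \<and> c3 = 0"
proof -
  have "c0 + b * c1 + s * c2 + s * b * c3 = 0" "c0 - b * c1 + s * c2 - s * b * c3 = 0"
    "c0 + b * c1 - s * c2 - s * b * c3 = 0" "c0 - b * c1 - s * c2 + s * b * c3 = 0"
    using assms(3)[of s b] assms(3)[of s "- b"] assms(3)[of "- s" b] assms(3)[of "- s" "- b"]
    by simp_all
  then have "c0 = 0" "b * c1 = 0" "s * c2 = 0" "s * b * c3 = 0"
    by linarith+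
  then show ?thesis using assms(1,2) by simp
qed

text \<open>Cross-multiplied, invariance becomes an identity that makes sense also where
  \<open>q\<close> vanishes.\<close>

lemma invariant_Fract_iff:
  assumes "q \<noteq> 0"
  shows "Fract p q \<in> invariant_rats \<longleftrightarrow>
    (\<forall>g x. poly_fun p (act g x) * poly_fun q x = poly_fun p x * poly_fun q (act g x))"
  using assms
  by (simp add: invariant_rats_def pull_rat_Fract eq_fract pull_poly_eq_0)
    (simp add: state_poly_eq_iff times_state_poly.rep_eq pull_poly.rep_eq)

text \<open>Invariance compares \<open>x\<close> with the four normal forms in its orbit, and
  \<open>sign_independence\<close> splits this into a proportion \<open>p : q = hi : ki\<close> for
  each component. The nonzero value of \<open>q\<close> on the slice supplies a component with
  \<open>ki\<close> nonzero at \<open>x0\<close>.\<close>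

lemma invariant_Fract_in_inv_field:
  assumes "q \<noteq> 0" "Fract p q \<in> invariant_rats"
    and x0: "generic x0" "s0^2 = inv_at 0 x0" "b0^2 = slice_b1_sq x0"
    and nz: "poly_fun q (normal_form x0 s0 b0) \<noteq> 0"
  shows "Fract p q \<in> inv_field"
proof -
  obtain h0 h1 h2 h3 where h: "inv_rational h0" "inv_rational h1" "inv_rational h2" "inv_rational h3"
    "\<And>x s b. generic x \<Longrightarrow> s^2 = inv_at 0 x \<Longrightarrow> b^2 = slice_b1_sq x \<Longrightarrow>
      poly_fun p (normal_form x s b) = h0 x + b * h1 x + s * h2 x + s * b * h3 x"
    using poly_fun_on_normal_form[of p] by blast
  obtain k0 k1 k2 k3 where k: "inv_rational k0" "inv_rational k1" "inv_rational k2" "inv_rational k3"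
    "\<And>x s b. generic x \<Longrightarrow> s^2 = inv_at 0 x \<Longrightarrow> b^2 = slice_b1_sq x \<Longrightarrow>
      poly_fun q (normal_form x s b) = k0 x + b * k1 x + s * k2 x + s * b * k3 x"
    using poly_fun_on_normal_form[of q] by blast
  have eq: "poly_fun p x * k0 x = poly_fun q x * h0 x \<and> poly_fun p x * k1 x = poly_fun q x * h1 x \<and>
      poly_fun p x * k2 x = poly_fun q x * h2 x \<and> poly_fun p x * k3 x = poly_fun q x * h3 x"
    if x: "generic x" for x
  proof -
    let ?p = "poly_fun p x" and ?q = "poly_fun q x"
    have "?p * k0 x - ?q * h0 x = 0 \<and> ?p * k1 x - ?q * h1 x = 0 \<and>
        ?p * k2 x - ?q * h2 x = 0 \<and> ?p * k3 x - ?q * h3 x = 0"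
    proof (rule sign_independence)
      show "sqrt (inv_at 0 x) \<noteq> 0" "sqrt (slice_b1_sq x) \<noteq> 0"
        using generic_pos[OF x] by simp_all
    next
      fix s b :: real
      assume "s^2 = (sqrt (inv_at 0 x))^2" "b^2 = (sqrt (slice_b1_sq x))^2"
      then have sb: "s^2 = inv_at 0 x" "b^2 = slice_b1_sq x"
        using generic_pos[OF x] by simp_all
      obtain g where "act g x = normal_form x s b"
        using act_to_normal_form[OF x sb] by blast
      then have "poly_fun p (normal_form x s b) * ?q = ?p * poly_fun q (normal_form x s b)"
        using assms(2) invariant_Fract_iff[OF assms(1)] by metis
      then show "?p * k0 x - ?q * h0 x + b * (?p * k1 x - ?q * h1 x) +
          s * (?p * k2 x - ?q * h2 x) + s * b * (?p * k3 x - ?q * h3 x) = 0"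
        unfolding h(5)[OF x sb] k(5)[OF x sb] by (simp add: algebra_simps)
    qed
    then show ?thesis by simp
  qed
  have "k0 x0 \<noteq> 0 \<or> k1 x0 \<noteq> 0 \<or> k2 x0 \<noteq> 0 \<or> k3 x0 \<noteq> 0"
    using nz unfolding k(5)[OF x0] by auto
  then show ?thesis
    using Fract_in_inv_field[OF h(1) k(1) _ x0(1) _ assms(1)]
      Fract_in_inv_field[OF h(2) k(2) _ x0(1) _ assms(1)]
      Fract_in_inv_field[OF h(3) k(3) _ x0(1) _ assms(1)]
      Fract_in_inv_field[OF h(4) k(4) _ x0(1) _ assms(1)] eq by blast
qed

lemma act_inv_left: "act (unitary2_inv g) (act g x) = x"
proof -
  have "unitary2_inv (unitary2_inv g) = g"
    by transfer simp
  then show ?thesis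
    using act_inv[of "unitary2_inv g" x] by simp
qed

lemma invariant_rats_subset: "invariant_rats \<subseteq> inv_field"
proof
  fix f assume f: "f \<in> invariant_rats"
  obtain p q where pq: "f = Fract p q" "q \<noteq> 0"
    by (cases f) auto
  \<comment> \<open>A nonzero value of this product yields one state that is generic and not a zero
    of \<open>q\<close>.\<close>
  have "q * generic_poly \<noteq> 0"
    using pq generic_poly_nonzero by simp
  then obtain x0 where x0: "poly_fun q x0 \<noteq> 0" "generic x0"
    unfolding state_poly_nonzero_iff by (auto simp: times_state_poly.rep_eq generic_poly_eq_0_iff)
  define s0 b0 where "s0 = sqrt (inv_at 0 x0)" and "b0 = sqrt (slice_b1_sq x0)"
  have sb: "s0^2 = inv_at 0 x0" "b0^2 = slice_b1_sq x0"
    using generic_pos[OF x0(2)] by (simp_all add: s0_def b0_def)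
  obtain g where g: "act g x0 = normal_form x0 s0 b0"
    using act_to_normal_form[OF x0(2) sb] by blast
  \<comment> \<open>The denominator may vanish identically on the slice; translating by a group element prevents this.\<close>
  define h where "h = unitary2_inv g"
  have "f = pull_rat h f"
    using f by (simp add: invariant_rats_def)
  then have F: "f = Fract (pull_poly h p) (pull_poly h q)"
    using pq by (simp add: pull_rat_Fract)
  have "poly_fun (pull_poly h q) (normal_form x0 s0 b0) \<noteq> 0"
    using x0(1) by (simp add: pull_poly.rep_eq h_def act_inv_left flip: g)
  then show "f \<in> inv_field"
    using invariant_Fract_in_inv_field[of "pull_poly h q" "pull_poly h p", OF _ _ x0(2) sb] f F pq(2)
    by (simp add: pull_poly_eq_0)
qed

section \<open>Invariance of the generated field\<close>

lemma pull_poly_diff: "pull_poly g (p - q) = pull_poly g p - pull_poly g q"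
  and pull_poly_1: "pull_poly g 1 = 1"
  by (simp_all add: state_poly_eq_iff pull_poly.rep_eq minus_state_poly.rep_eq
      one_state_poly.rep_eq)

lemma pull_rat_1: "pull_rat g 1 = 1"
  by (simp add: One_fract_def pull_rat_Fract pull_poly_1)

lemma pull_rat_diff: "pull_rat g (f - f') = pull_rat g f - pull_rat g f'"
  by (cases f, cases f')
    (simp add: pull_rat_Fract pull_poly_eq_0 pull_poly_mult pull_poly_diff)

lemma pull_rat_mult: "pull_rat g (f * f') = pull_rat g f * pull_rat g f'"
  by (cases f, cases f') (simp add: pull_rat_Fract pull_poly_mult)

lemma pull_rat_0: "pull_rat g 0 = 0"
  using pull_rat_diff[of g 0 0] by simp

lemma pull_rat_inverse: "pull_rat g (inverse f) = inverse (pull_rat g f)"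
proof (cases f)
  case (Fract p q)
  then show ?thesis
    \<comment> \<open>For \<open>p = 0\<close> the inverse is 0 by convention, so inverting the
      fraction does not swap numerator and denominator.\<close>
    by (cases "p = 0") (simp_all add: pull_rat_Fract pull_poly_eq_0 pull_rat_0 fract_collapse)
qed

text \<open>Pullback respects every rule that generates the field, so it suffices that it fixes
  constants and generators.\<close>

lemma inv_field_subset: "inv_field \<subseteq> invariant_rats"
proof
  fix f assume "f \<in> inv_field"
  then have "pull_rat g f = f" for g
    unfolding inv_field_def
  proof induction
    case (incl x)
    then obtain u where "x = Fract u 1" "pull_poly g u = u"
      by (force simp: const_rat_def state_poly_eq_iff pull_poly.rep_eq const_poly.rep_eq inv_at_act)
    then show ?case
      by (simp add: pull_rat_Fract pull_poly_1)
  qed (simp_all add: pull_rat_1 pull_rat_diff pull_rat_mult pull_rat_inverse)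
  then show "f \<in> invariant_rats"
    by (simp add: invariant_rats_def)
qed

section \<open>Algebraic independence of the generators\<close>

text \<open>With the other variables fixed, the sum is a polynomial in the last one with infinitely
  many roots, so each of its coefficients vanishes. The coefficient at exponent \<open>e m n\<close>
  is a sum over the monomials sharing that exponent, to which the induction hypothesis
  applies.\<close>

lemma coeffs_zero_if_zero_on_box:
  fixes c :: "'m \<Rightarrow> real" and e :: "'m \<Rightarrow> nat \<Rightarrow> nat"
  assumes "finite M" "\<And>i. i < n \<Longrightarrow> infinite (A i)"
    and "\<And>m m'. m \<in> M \<Longrightarrow> m' \<in> M \<Longrightarrow> (\<And>i. i < n \<Longrightarrow> e m i = e m' i) \<Longrightarrow> m = m'"
    and "\<And>y. (\<And>i. i < n \<Longrightarrow> y i \<in> A i) \<Longrightarrow> (\<Sum>m\<in>M. c m * (\<Prod>i<n. y i ^ e m i)) = 0"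
    and "m \<in> M"
  shows "c m = 0"
  using assms
proof (induction n arbitrary: M)
  case 0
  \<comment> \<open>Without variables, the separation hypothesis identifies all members of
    \<open>M\<close>.\<close>
  then have "M = {m}" by auto
  then show ?case using "0.prems"(4) by simp
next
  case (Suc n)
  let ?M = "{m' \<in> M. e m' n = e m n}"
  show ?case
  proof (rule Suc.IH)
    show "finite ?M" using Suc.prems(1) by simp
    show "infinite (A i)" if "i < n" for i using Suc.prems(2) that by simp
    show "m1 = m2" if "m1 \<in> ?M" "m2 \<in> ?M" "\<And>i. i < n \<Longrightarrow> e m1 i = e m2 i" for m1 m2
      by (rule Suc.prems(3)) (use that in \<open>auto simp: less_Suc_eq\<close>)
    show "m \<in> ?M" using Suc.prems(5) by simp
  next
    fix y assume y: "\<And>i. i < n \<Longrightarrow> y i \<in> A i"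
    define d where "d m' = c m' * (\<Prod>i<n. y i ^ e m' i)" for m'
    define Q where "Q = (\<Sum>m'\<in>M. monom (d m') (e m' n))"
    have "poly Q t = 0" if "t \<in> A n" for t
    proof -
      have "(\<Sum>m'\<in>M. c m' * (\<Prod>i<Suc n. (y(n := t)) i ^ e m' i)) = 0"
        by (rule Suc.prems(4)) (use y that in \<open>auto simp: less_Suc_eq\<close>)
      moreover have "(\<Prod>i<n. (y(n := t)) i ^ e m' i) = (\<Prod>i<n. y i ^ e m' i)" for m'
        by (rule prod.cong) auto
      ultimately show ?thesis
        by (simp add: Q_def d_def poly_sum poly_monom mult.assoc)
    qed
    then have "A n \<subseteq> {t. poly Q t = 0}" by auto
    then have "Q = 0"
      using Suc.prems(2)[of n] poly_roots_finite[of Q] finite_subset by auto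
    then have "0 = coeff Q (e m n)" by simp
    also have "\<dots> = (\<Sum>m'\<in>M. if e m' n = e m n then d m' else 0)"
      by (simp add: Q_def coeff_sum)
    also have "\<dots> = (\<Sum>m'\<in>?M. d m')"
      using Suc.prems(1) by (simp add: sum.inter_filter)
    finally show "(\<Sum>m'\<in>?M. c m' * (\<Prod>i<n. y i ^ e m' i)) = 0"
      by (simp add: d_def)
  qed
qed

lemma Fract_sum: "(\<Sum>i\<in>I. Fract (f i) 1) = Fract (\<Sum>i\<in>I. f i) (1 :: 'a::idom)"
  by (induction I rule: infinite_finite_induct) (simp_all add: fract_collapse)

lemma Fract_prod: "(\<Prod>i\<in>I. Fract (f i) 1) = Fract (\<Prod>i\<in>I. f i) (1 :: 'a::idom)"
  by (induction I rule: infinite_finite_induct) (simp_all add: fract_collapse)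

lemma Fract_power: "Fract a 1 ^ k = Fract (a ^ k) (1 :: 'a::idom)"
  by (induction k) (simp_all add: fract_collapse)

lemma poly_fun_sum: "poly_fun (\<Sum>i\<in>I. f i) x = (\<Sum>i\<in>I. poly_fun (f i) x)"
  by (induction I rule: infinite_finite_induct)
    (simp_all add: zero_state_poly.rep_eq plus_state_poly.rep_eq)

lemma poly_fun_prod: "poly_fun (\<Prod>i\<in>I. f i) x = (\<Prod>i\<in>I. poly_fun (f i) x)"
  by (induction I rule: infinite_finite_induct)
    (simp_all add: one_state_poly.rep_eq times_state_poly.rep_eq)

lemma poly_fun_power: "poly_fun (f ^ k) x = poly_fun f x ^ k"
  by (induction k) (simp_all add: one_state_poly.rep_eq times_state_poly.rep_eq)

text \<open>The formulas for the slice parameters are applied to prescribed values; the two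
  positivity conditions provide the real square roots \<open>s\<close> and
  \<open>b1\<close>.\<close>

lemma inv_at_attains:
  assumes "y 0 > 0" "y 0 * y 2 - (y 1)\<^sup>2 > 0"
  shows "\<exists>x. \<forall>i<6. inv_at i x = y i"
proof -
  define s where "s = sqrt (y 0)"
  define a1 where "a1 = y 1 / y 0"
  define b1 where "b1 = sqrt (y 2 / y 0 - a1^2)"
  define a2 where "a2 = (y 3 / y 0 - a1^3 - 2 * a1 * b1^2) / b1^2"
  define b2 where "b2 = y 4 / (s^3 * b1^2)"
  define a3 where "a3 = y 5 - a1 - a2"
  have "y 2 / y 0 - a1^2 = (y 0 * y 2 - (y 1)\<^sup>2) / (y 0)\<^sup>2"
    using assms(1) by (simp add: a1_def field_simps power2_eq_square)
  then have "y 2 / y 0 - a1^2 > 0"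
    using assms by simp
  then have b: "b1^2 = y 2 / y 0 - a1^2" "b1 \<noteq> 0"
    by (simp_all add: b1_def)
  have s: "s^2 = y 0" "s \<noteq> 0"
    using assms(1) by (simp_all add: s_def)
  have a2: "a2 * b1^2 = y 3 / y 0 - a1^3 - 2 * a1 * b1^2"
    using b(2) by (simp add: a2_def)
  have a1: "y 0 * a1 = y 1"
    using assms(1) by (simp add: a1_def)
  have b2: "s^3 * b1^2 * b2 = y 4"
    using s(2) b(2) by (simp add: b2_def)
  let ?x = "slice_state s a1 b1 a2 b2 a3"
  have "inv_at 0 ?x = y 0" "inv_at (Suc 0) ?x = y 1" "inv_at 2 ?x = y 2" "inv_at 3 ?x = y 3"
    "inv_at 4 ?x = y 4" "inv_at 5 ?x = y 5"
    unfolding inv_at_slice_state s(1) a1 a2 b2 using assms(1) by (simp_all add: b(1) a3_def)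
  then have "inv_at i ?x = y i" if "i < 6" for i
    using that by (auto simp: eval_nat_numeral less_Suc_eq)
  then show ?thesis by blast
qed

text \<open>A relation would vanish on the joint image of the invariants, which contains a product
  of six open intervals.\<close>

lemma alg_independent_invariants:
  "alg_independent const_rat 6 (\<lambda>i. Fract (inv_poly i) 1)"
  unfolding alg_independent_def
proof (intro allI impI)
  fix P :: "(nat \<Rightarrow>\<^sub>0 nat) \<Rightarrow>\<^sub>0 real"
  assume keys: "\<forall>m\<in>Poly_Mapping.keys P. Poly_Mapping.keys m \<subseteq> {..<6}"
    and 0: "poly_eval const_rat (\<lambda>i. Fract (inv_poly i) 1) P = 0"
  let ?M = "Poly_Mapping.keys P" and ?c = "Poly_Mapping.lookup P"
  let ?e = Poly_Mapping.lookup
  define U where "U = (\<Sum>m\<in>?M. const_poly (?c m) *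
      (\<Prod>i\<in>Poly_Mapping.keys m. inv_poly i ^ ?e m i))"
  have "Fract U 1 = 0"
    using 0 by (simp add: poly_eval_def U_def const_rat_def Fract_sum Fract_prod Fract_power)
  then have "U = 0"
    by (simp add: Zero_fract_def eq_fract)
  then have "poly_fun U x = 0" for x
    by (simp add: zero_state_poly.rep_eq)
  then have z: "(\<Sum>m\<in>?M. ?c m * (\<Prod>i\<in>Poly_Mapping.keys m. inv_at i x ^ ?e m i)) = 0" for x
    by (simp add: U_def poly_fun_sum poly_fun_prod poly_fun_power times_state_poly.rep_eq
        const_poly.rep_eq)
  \<comment> \<open>These intervals force \<open>(y 1)^2 < 1 < y 0 * y 2\<close>, so
    \<open>inv_at_attains\<close> covers the whole box.\<close>
  define A :: "nat \<Rightarrow> real set" where "A i = (if i = 1 then {0<..<1} else {1<..<2})" for i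
  have "?c m = 0" if "m \<in> ?M" for m
  proof (rule coeffs_zero_if_zero_on_box[where M = ?M and c = ?c and e = ?e and n = 6 and A = A])
    show "infinite (A i)" for i
      by (simp add: A_def)
    show "m1 = m2" if "m1 \<in> ?M" "m2 \<in> ?M" "\<And>i. i < 6 \<Longrightarrow> ?e m1 i = ?e m2 i" for m1 m2
    proof (rule poly_mapping_eqI)
      fix i
      show "?e m1 i = ?e m2 i"
      proof (cases "i < 6")
        case False
        then have "i \<notin> Poly_Mapping.keys m1" "i \<notin> Poly_Mapping.keys m2"
          using keys that(1,2) by auto
        then show ?thesis by (simp add: in_keys_iff)
      qed (rule that(3))
    qed
  next
    fix y assume y: "\<And>i. i < (6::nat) \<Longrightarrow> y i \<in> A i"
    have "y 0 > 1" "y 2 > 1" "0 < y 1" "y 1 < 1"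
      using y[of 0] y[of 1] y[of 2] by (simp_all add: A_def)
    then have "(y 1)\<^sup>2 < 1" "1 < y 0 * y 2"
      by (simp_all add: power_less_one_iff less_1_mult)
    then obtain x where x: "\<And>i. i < 6 \<Longrightarrow> inv_at i x = y i"
      using inv_at_attains[of y] \<open>y 0 > 1\<close> by auto
    have "(\<Prod>i<6. y i ^ ?e m i) = (\<Prod>i\<in>Poly_Mapping.keys m. inv_at i x ^ ?e m i)" if "m \<in> ?M" for m
    proof -
      \<comment> \<open>Indices outside the support have exponent 0 and contribute the factor
        1.\<close>
      have "(\<Prod>i\<in>Poly_Mapping.keys m. inv_at i x ^ ?e m i) = (\<Prod>i<6. inv_at i x ^ ?e m i)"
        by (rule prod.mono_neutral_left) (use keys that in \<open>auto simp: in_keys_iff\<close>)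
      then show ?thesis by (simp add: x)
    qed
    then show "(\<Sum>m\<in>?M. ?c m * (\<Prod>i<6. y i ^ ?e m i)) = 0"
      using z[of x] by simp
  qed (use that in simp_all)
  then show "P = 0"
    by (intro poly_mapping_eqI) (auto simp: in_keys_iff)
qed

theorem theorem2:
  shows "purely_transcendental const_rat invariant_rats 6"
proof -
  have "invariant_rats = inv_field"
    using invariant_rats_subset inv_field_subset by blast
  then show ?thesis
    unfolding purely_transcendental_def inv_field_def using alg_independent_invariants by blast
qed

end
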